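(* Let $m\ge 2$, let $(G_\ell(m,d))_{\ell\ge1}$ be a sequence of random groups with $m$ generators and with density $d\in\{-\infty\}\cup[0,1]$, and let $0<\lambda<1$. 1. If $d<\lambda/2$, then asymptotically almost surely (as $\ell\to\infty$) $G_\ell(m,d)$ satisfies the small cancellation condition $C'(\lambda)$. 2. If $d>\lambda/2$, then asymptotically almost surely (as $\ell\to\infty$) $G_\ell(m,d)$ does not satisfy $C'(\lambda)$.
   Context: Random groups. Fix $X=\{x_1,\dots,x_m\}$ and let $B_\ell$ be the set of (nonempty) cyclically reduced words of length at most $\ell$ on $X^{\pm}=\{x_1^{\pm1},\dots,x_m^{\pm1}\}$ (a word is cyclically reduced if it is reduced and its last letter is not the inverse of its first letter). A random subset $R$ of a finite set $B$ is a $\mathcal P(B)$-valued random variable; it is permutation invariant if $\Pr(R=r)=\Pr(R=\sigma(r))$ for every $r\subseteq B$ and every permutation $\sigma$ of the set $B$. A sequence $\mathbf R=(R_\ell)$ of random subsets $R_\ell$ of $B_\ell$ is densable with density $d\in\{-\infty\}\cup[0,1]$ if $\log_{|B_\ell|}|R_\ell|$ (with $\log 0=-\infty$) converges in distribution to the constant $d$ as $\ell\to\infty$. A sequence of random groups with $m$ generators and density $d$ is a sequence of random presentations $G_\ell(m,d)=\langle X\mid R_\ell\rangle$, where $(R_\ell)$ is a densable sequence of permutation invariant random subsets of $(B_\ell)$ with density $d$. An event $Q_\ell$ holds asymptotically almost surely if $\Pr(Q_\ell)\to1$ as $\ell\to\infty$. Small cancellation. Let $R$ be a set of cyclically reduced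 words. Regard relators as cyclic words that may be read in either direction. A piece with respect to $R$ is a cyclic subword that appears at least twice, i.e. either in two distinct relators, or twice in the same relator (at two different positions, possibly in opposite orientations). The presentation $\langle X\mid R\rangle$ satisfies $C'(\lambda)$ if every piece $p$ occurring in a relator $r$ satisfies $|p|<\lambda|r|$, where $|\cdot|$ denotes word length. *)

theory Defs
  imports
    "HOL-Probability.Probability"
    "HOL-Combinatorics.Permutations"
    "HOL-Library.Sublist"
begin

section \<open>Words\<close>

text \<open>The letter \<open>(i, True)\<close> stands for \<open>x\<^sub>i\<close> and \<open>(i, False)\<close> for its formal inverse.\<close>

type_synonym letter = "nat \<times> bool"
type_synonym word = "letter list"

definition letters :: "nat \<Rightarrow> letter set" where
  "letters m = {1..m} \<times> UNIV"

definition inv_letter :: "letter \<Rightarrow> letter" where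
  "inv_letter x = (fst x, \<not> snd x)"

definition inv_word :: "word \<Rightarrow> word" where
  "inv_word w = rev (map inv_letter w)"

definition reduced :: "word \<Rightarrow> bool" where
  "reduced w \<longleftrightarrow> successively (\<lambda>x y. y \<noteq> inv_letter x) w"

definition cyclically_reduced :: "word \<Rightarrow> bool" where
  "cyclically_reduced w \<longleftrightarrow> reduced w \<and> (w \<noteq> [] \<longrightarrow> last w \<noteq> inv_letter (hd w))"

definition cyc_words :: "nat \<Rightarrow> nat \<Rightarrow> word set" where
  "cyc_words m l =
     {w. set w \<subseteq> letters m \<and> w \<noteq> [] \<and> cyclically_reduced w \<and> length w \<le> l}"

section \<open>Small cancellation\<close>

text \<open>
  \<open>occurs_at p r b i\<close>: the cyclic word \<open>r\<close>, read in the direction given by \<open>b\<close> (\<open>False\<close>: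
  backwards, i.e. reading the inverse word) from position \<open>i\<close> and at most once around,
  starts with \<open>p\<close>. In particular \<open>length p \<le> length r\<close>.

  For \<open>b = False\<close> positions are counted along the inverse word. No care is needed to compare
  positions of opposite orientation: a nonempty \<open>p\<close> and its inverse cannot occur at
  overlapping places of a cyclically reduced word.
\<close>

definition occurs_at :: "word \<Rightarrow> word \<Rightarrow> bool \<Rightarrow> nat \<Rightarrow> bool" where
  "occurs_at p r b i \<longleftrightarrow>
     i < length r \<and> prefix p (rotate i (if b then r else inv_word r))"

definition piece :: "word set \<Rightarrow> word \<Rightarrow> bool" where
  "piece R p \<longleftrightarrow>
     (\<exists>r1\<in>R. \<exists>r2\<in>R. \<exists>b1 b2 i1 i2.
        occurs_at p r1 b1 i1 \<and> occurs_at p r2 b2 i2 \<and> (r1, b1, i1) \<noteq> (r2, b2, i2))"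

definition small_cancellation :: "real \<Rightarrow> word set \<Rightarrow> bool" where
  "small_cancellation c R \<longleftrightarrow>
     (\<forall>p r. piece R p \<longrightarrow> r \<in> R \<longrightarrow> (\<exists>b i. occurs_at p r b i) \<longrightarrow>
        real (length p) < c * real (length r))"

section \<open>Random subsets and densities\<close>

definition random_subset :: "'a measure \<Rightarrow> 'b set \<Rightarrow> ('a \<Rightarrow> 'b set) \<Rightarrow> bool" where
  "random_subset M B R \<longleftrightarrow> prob_space M \<and> R \<in> measurable M (count_space (Pow B))"

definition permutation_invariant :: "'a measure \<Rightarrow> 'b set \<Rightarrow> ('a \<Rightarrow> 'b set) \<Rightarrow> bool" where
  "permutation_invariant M B R \<longleftrightarrow>
     (\<forall>r \<sigma>. r \<subseteq> B \<longrightarrow> \<sigma> permutes B \<longrightarrow>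
        \<P>(\<omega> in M. R \<omega> = r) = \<P>(\<omega> in M. R \<omega> = \<sigma> ` r))"

definition converges_in_distribution_to_const ::
    "(nat \<Rightarrow> 'a measure) \<Rightarrow> (nat \<Rightarrow> 'a \<Rightarrow> 'b::topological_space) \<Rightarrow> 'b \<Rightarrow> bool" where
  "converges_in_distribution_to_const M Y c \<longleftrightarrow>
     (\<forall>f :: 'b \<Rightarrow> real. continuous_on UNIV f \<longrightarrow> bounded (range f) \<longrightarrow>
        (\<lambda>l. \<integral>\<omega>. f (Y l \<omega>) \<partial>(M l)) \<longlonglongrightarrow> f c)"

text \<open>\<open>log_card B r\<close> is the logarithm of \<open>card r\<close> to base \<open>card B\<close>, with \<open>log 0 = -\<infinity>\<close>.\<close>

definition log_card :: "'b set \<Rightarrow> 'b set \<Rightarrow> ereal" where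
  "log_card B r = (if card r = 0 then -\<infinity> else ereal (log (real (card B)) (real (card r))))"

definition densable_with_density ::
    "(nat \<Rightarrow> 'a measure) \<Rightarrow> (nat \<Rightarrow> 'b set) \<Rightarrow> (nat \<Rightarrow> 'a \<Rightarrow> 'b set) \<Rightarrow> ereal \<Rightarrow> bool" where
  "densable_with_density M B R d \<longleftrightarrow>
     converges_in_distribution_to_const M (\<lambda>l \<omega>. log_card (B l) (R l \<omega>)) d"

section \<open>Random groups\<close>

text \<open>
  A random presentation on the generators \<open>x\<^sub>1, \<dots>, x\<^sub>m\<close> is given by its random set \<open>R l\<close> of
  relators; each \<open>R l\<close> may live on its own probability space \<open>M l\<close>.
\<close>

definition random_groups ::
    "nat \<Rightarrow> ereal \<Rightarrow> (nat \<Rightarrow> 'a measure) \<Rightarrow> (nat \<Rightarrow> 'a \<Rightarrow> word set) \<Rightarrow> bool" where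
  "random_groups m d M R \<longleftrightarrow>
     (\<forall>l\<ge>1. random_subset (M l) (cyc_words m l) (R l) \<and>
             permutation_invariant (M l) (cyc_words m l) (R l)) \<and>
     densable_with_density M (cyc_words m) R d"

definition asymptotically_almost_surely ::
    "(nat \<Rightarrow> 'a measure) \<Rightarrow> (nat \<Rightarrow> 'a \<Rightarrow> bool) \<Rightarrow> bool" where
  "asymptotically_almost_surely M Q \<longleftrightarrow> (\<lambda>l. \<P>(\<omega> in M l. Q l \<omega>)) \<longlonglongrightarrow> 1"

end

theory Submission
  imports Defs "HOL-Real_Asymp.Real_Asymp"
begin

text \<open>
  Write \<open>q = 2 * m - 1\<close>, so that \<open>cyc_words m l\<close> has about \<open>N = q ^ l\<close> elements. By permutation
  invariance the random set is uniform among the sets of its cardinality \<open>k\<close>, and \<open>k\<close> is close to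
  \<open>N powr d\<close>, so probabilities become proportions of \<open>k\<close>-element sets.

  Below the critical density this is a first moment estimate. There are at most about
  \<open>q powr ((2 - c) * l)\<close> pairs of distinct words that share a subword of length \<open>c * length r\<close>, where
  \<open>r\<close> is one of the two, and a given pair lies in the random set with probability about
  \<open>(k / N) ^ 2\<close>. A word containing such a subword twice has a block of about half that
  length which is determined by the remaining letters; there are at most about
  \<open>q powr ((1 - c / 2) * l)\<close> such words, each chosen with probability \<open>k / N\<close>.

  Above the critical density a birthday argument applies. If two relators agree in their first
  \<open>c * l\<close> letters, they violate the condition. Each relator rules out
  about \<open>s = q powr ((1 - c) * l)\<close> words as further relators, and these sets are disjoint for relators
  that do not violate the condition. Hence the proportion of \<open>k\<close>-element sets without violation is at
  most about \<open>exp (- k ^ 2 * s / (2 * N))\<close>.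
\<close>

section \<open>From probabilities to counting: permutation invariance and convergence in
  distribution\<close>

section \<open>Random subsets\<close>

text \<open>Matching \<open>r\<close> with \<open>s\<close> and, separately, their complements shows
  that the symmetric group of \<open>B\<close> acts transitively on the subsets of a given
  cardinality. Invariance thereby makes such subsets equally likely.\<close>

lemma ex_permutes_image_eq:
  assumes "finite B" "r \<subseteq> B" "s \<subseteq> B" "card r = card s"
  shows "\<exists>\<sigma>. \<sigma> permutes B \<and> \<sigma> ` r = s"
proof -
  have fin: "finite r" "finite s" using assms by (auto intro: finite_subset)
  obtain f where f: "bij_betw f r s"
    using finite_same_card_bij[OF fin assms(4)] by blast
  have "card (B - r) = card (B - s)"
    using assms fin by (simp add: card_Diff_subset)
  then obtain g where g: "bij_betw g (B - r) (B - s)"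
    using finite_same_card_bij[of "B - r" "B - s"] assms(1) by blast
  define \<sigma> where "\<sigma> x = (if x \<in> r then f x else if x \<in> B then g x else x)" for x
  have 1: "bij_betw \<sigma> r s" using f by (rule bij_betw_cong[THEN iffD1, rotated]) (simp add: \<sigma>_def)
  have 2: "bij_betw \<sigma> (B - r) (B - s)"
    using g by (rule bij_betw_cong[THEN iffD1, rotated]) (simp add: \<sigma>_def)
  have "bij_betw \<sigma> (r \<union> (B - r)) (s \<union> (B - s))"
    by (rule bij_betw_combine[OF 1 2]) auto
  moreover have "r \<union> (B - r) = B" "s \<union> (B - s) = B" using assms by auto
  ultimately have "bij_betw \<sigma> B B" by simp
  hence "\<sigma> permutes B"
    by (rule bij_imp_permutes) (use assms in \<open>auto simp: \<sigma>_def\<close>)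
  thus ?thesis using 1 by (auto simp: bij_betw_def)
qed

lemma random_subset_sets:
  assumes "random_subset M B R"
  shows "{\<omega> \<in> space M. P (R \<omega>)} \<in> sets M"
proof -
  have R: "R \<in> measurable M (count_space (Pow B))" using assms by (simp add: random_subset_def)
  have "R -` {r \<in> Pow B. P r} \<inter> space M \<in> sets M"
    by (rule measurable_sets[OF R]) auto
  also have "R -` {r \<in> Pow B. P r} \<inter> space M = {\<omega> \<in> space M. P (R \<omega>)}"
    using measurable_space[OF R] by auto
  finally show ?thesis .
qed

lemma random_subset_prob_mem:
  assumes "random_subset M B R" "finite F"
  shows "\<P>(\<omega> in M. R \<omega> \<in> F) = (\<Sum>r\<in>F. \<P>(\<omega> in M. R \<omega> = r))"
proof -
  interpret prob_space M using assms by (simp add: random_subset_def)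
  have "{\<omega> \<in> space M. R \<omega> \<in> F} = (\<Union>r\<in>F. {\<omega> \<in> space M. R \<omega> = r})" by auto
  moreover have "measure M (\<Union>r\<in>F. {\<omega> \<in> space M. R \<omega> = r})
      = (\<Sum>r\<in>F. measure M {\<omega> \<in> space M. R \<omega> = r})"
    by (rule finite_measure_finite_Union[OF assms(2)])
       (auto simp: disjoint_family_on_def intro: random_subset_sets[OF assms(1)])
  ultimately show ?thesis by simp
qed

text \<open>All sets of cardinality \<open>k\<close> carry the same probability
  \<open>\<pi> k\<close>. Comparing \<open>F\<close> layer by layer with \<open>Pow B\<close>, whose
  probability is at most 1, transfers a proportion bound that is uniform in \<open>k\<close>,
  whatever the distribution of the cardinality.\<close>

lemma permutation_invariant_prob_le:
  assumes RS: "random_subset M B R" and PI: "permutation_invariant M B R"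
    and B: "finite B" and F: "F \<subseteq> Pow B"
    and le: "\<And>k. k \<le> card B \<Longrightarrow>
      real (card {r \<in> F. card r = k}) \<le> \<epsilon> * real (card B choose k)"
    and "\<epsilon> \<ge> 0"
  shows "\<P>(\<omega> in M. R \<omega> \<in> F) \<le> \<epsilon>"
proof -
  interpret prob_space M using RS by (simp add: random_subset_def)
  have finF: "finite F" using F B finite_subset by blast
  have "\<exists>\<pi>. \<forall>r. r \<subseteq> B \<and> card r = k \<longrightarrow> \<P>(\<omega> in M. R \<omega> = r) = \<pi>" for k
  proof (cases "\<exists>r0. r0 \<subseteq> B \<and> card r0 = k")
    case True
    then obtain r0 where r0: "r0 \<subseteq> B" "card r0 = k" by auto
    have "\<P>(\<omega> in M. R \<omega> = r) = \<P>(\<omega> in M. R \<omega> = r0)" if r: "r \<subseteq> B \<and> card r = k" for r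
    proof -
      obtain \<sigma> where "\<sigma> permutes B" "\<sigma> ` r = r0"
        using ex_permutes_image_eq[OF B, of r r0] r r0 by auto
      thus ?thesis
        using PI[unfolded permutation_invariant_def, rule_format, of r \<sigma>] r by simp
    qed
    thus ?thesis by blast
  qed auto
  hence "\<forall>k. \<exists>\<pi>. \<forall>r. r \<subseteq> B \<and> card r = k \<longrightarrow> \<P>(\<omega> in M. R \<omega> = r) = \<pi>" ..
  from choice[OF this] obtain \<pi> where
    \<pi>: "\<And>k r. r \<subseteq> B \<Longrightarrow> card r = k \<Longrightarrow> \<P>(\<omega> in M. R \<omega> = r) = \<pi> k"
    by blast
  \<comment> \<open>Beyond \<open>card B\<close> no subset constrains \<open>\<pi>\<close>, so
    nonnegativity is available only in this range.\<close>
  have pos: "\<pi> k \<ge> 0" if k: "k \<le> card B" for k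
  proof -
    obtain r where "r \<subseteq> B" "card r = k" using obtain_subset_with_card_n[OF k] by blast
    thus ?thesis using \<pi>[of r k] measure_nonneg[of M "{\<omega> \<in> space M. R \<omega> = r}"] by simp
  qed
  have split: "\<P>(\<omega> in M. R \<omega> \<in> G) = (\<Sum>k\<le>card B. real (card {r \<in> G. card r = k}) * \<pi> k)"
    if G: "G \<subseteq> Pow B" for G
  proof -
    have finG: "finite G" using G B finite_subset by blast
    have "\<P>(\<omega> in M. R \<omega> \<in> G) = (\<Sum>r\<in>G. \<P>(\<omega> in M. R \<omega> = r))"
      by (rule random_subset_prob_mem[OF RS finG])
    also have "\<dots> = (\<Sum>r\<in>G. \<pi> (card r))"
      using G \<pi> by (intro sum.cong) auto
    also have "\<dots> = (\<Sum>k\<le>card B. \<Sum>r\<in>{r \<in> G. card r = k}. \<pi> (card r))"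
    proof (rule sum.group[symmetric])
      show "card ` G \<subseteq> {..card B}" using G B by (auto intro: card_mono)
    qed (use finG in auto)
    also have "\<dots> = (\<Sum>k\<le>card B. real (card {r \<in> G. card r = k}) * \<pi> k)"
      by (intro sum.cong) auto
    finally show ?thesis .
  qed
  have "\<P>(\<omega> in M. R \<omega> \<in> F) \<le> (\<Sum>k\<le>card B. (\<epsilon> * real (card B choose k)) * \<pi> k)"
    unfolding split[OF F] using le pos by (intro sum_mono mult_right_mono) auto
  also have "\<dots> = \<epsilon> * (\<Sum>k\<le>card B. real (card {r \<in> Pow B. card r = k}) * \<pi> k)"
    using n_subsets[OF B] by (simp add: sum_distrib_left mult.assoc)
  also have "\<dots> = \<epsilon> * \<P>(\<omega> in M. R \<omega> \<in> Pow B)"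
    using split[of "Pow B"] by simp
  also have "\<dots> \<le> \<epsilon> * 1"
    using assms by (intro mult_left_mono) auto
  finally show ?thesis by simp
qed

text \<open>Clamping to the interval from \<open>a\<close> to \<open>b\<close> before passing to the
  reals avoids the infinite points, where \<open>real_of_ereal\<close> is not continuous; an affine
  rescaling does the rest.\<close>

lemma ereal_test_function:
  fixes a b :: real
  assumes "a < b"
  obtains f :: "ereal \<Rightarrow> real" where "continuous_on UNIV f" "\<And>x. f x \<in> {0..1}"
    "\<And>x. x \<le> ereal a \<Longrightarrow> f x = 0" "\<And>x. x \<ge> ereal b \<Longrightarrow> f x = 1"
proof
  let ?g = "\<lambda>x. min (ereal b) (max (ereal a) x)"
  let ?f = "\<lambda>x. (real_of_ereal (?g x) - a) / (b - a)"
  have g: "\<exists>r. ?g x = ereal r \<and> a \<le> r \<and> r \<le> b \<and>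
      (x \<le> ereal a \<longrightarrow> r = a) \<and> (x \<ge> ereal b \<longrightarrow> r = b)" for x
  proof (cases x)
    case (real r)
    show ?thesis
      unfolding real using assms
      by (intro exI[of _ "min b (max a r)"]) (simp flip: ereal_max ereal_min)
  next
    case PInf
    thus ?thesis using assms by (auto intro!: exI[of _ b])
  next
    case MInf
    thus ?thesis using assms by (auto intro!: exI[of _ a])
  qed
  have "continuous_on UNIV (\<lambda>x. real_of_ereal (?g x))"
  proof (rule continuous_on_compose2[where f = ?g and g = real_of_ereal])
    show "continuous_on (UNIV - {\<infinity>, -\<infinity>::ereal}) real_of_ereal"
      by (rule continuous_on_real)
    show "continuous_on UNIV ?g" by (intro continuous_intros)
    show "range ?g \<subseteq> UNIV - {\<infinity>, -\<infinity>}"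
    proof
      fix y assume "y \<in> range ?g"
      then obtain x where "y = ?g x" by blast
      thus "y \<in> UNIV - {\<infinity>, -\<infinity>}" using g[of x] by force
    qed
  qed
  thus "continuous_on UNIV ?f" using assms by (intro continuous_intros) auto
  show "?f x \<in> {0..1}" for x
  proof -
    obtain r where "?g x = ereal r" "a \<le> r" "r \<le> b" using g[of x] by blast
    thus ?thesis using assms by (simp add: divide_simps)
  qed
  show "?f x = 0" if "x \<le> ereal a" for x
  proof -
    have "?g x = ereal a" using g[of x] that by blast
    thus ?thesis by simp
  qed
  show "?f x = 1" if "x \<ge> ereal b" for x
  proof -
    have "?g x = ereal b" using g[of x] that by blast
    thus ?thesis using assms by simp
  qed
qed

lemma random_subset_integral_ge_prob:
  assumes RS: "random_subset M B R"
    and f: "\<And>x. f x \<in> {0..(1::real)}" "\<And>x. P x \<Longrightarrow> f x = 1"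
  shows "\<P>(\<omega> in M. P (R \<omega>)) \<le> (\<integral>\<omega>. f (R \<omega>) \<partial>M)"
proof -
  interpret prob_space M using RS by (simp add: random_subset_def)
  have R[measurable]: "R \<in> measurable M (count_space (Pow B))"
    using RS by (simp add: random_subset_def)
  have int: "integrable M (\<lambda>\<omega>. f (R \<omega>))"
  proof (rule integrable_const_bound[where B = 1])
    show "(\<lambda>\<omega>. f (R \<omega>)) \<in> borel_measurable M"
      by (rule measurable_compose[OF R]) auto
  qed (use f(1) in auto)
  have "\<P>(\<omega> in M. P (R \<omega>)) = (\<integral>\<omega>. indicator {\<omega> \<in> space M. P (R \<omega>)} \<omega> \<partial>M)"
    using random_subset_sets[OF RS, of P] by simp
  also have "\<dots> \<le> (\<integral>\<omega>. f (R \<omega>) \<partial>M)"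
  proof (rule integral_mono)
    show "integrable M (indicator {\<omega> \<in> space M. P (R \<omega>)} :: _ \<Rightarrow> real)"
      using random_subset_sets[OF RS, of P] by (simp add: emeasure_eq_measure)
  qed (use int f in \<open>auto simp: indicator_def\<close>)
  finally show ?thesis .
qed

text \<open>A bounded continuous function that vanishes at \<open>d\<close> and equals 1 from
  \<open>b\<close> on dominates the indicator of the tail, and its expectation tends to its value 0
  at \<open>d\<close>.\<close>

lemma converges_in_distribution_prob_ge:
  assumes conv: "converges_in_distribution_to_const M (\<lambda>l \<omega>. Y l (R l \<omega>)) (d :: ereal)"
    and RS: "\<forall>\<^sub>F l in sequentially. random_subset (M l) (B l) (R l)"
    and d: "d < ereal b"
  shows "(\<lambda>l. \<P>(\<omega> in M l. Y l (R l \<omega>) \<ge> ereal b)) \<longlonglongrightarrow> 0"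
proof -
  \<comment> \<open>A real \<open>a\<close> between \<open>d\<close> and \<open>b\<close> puts
    \<open>d\<close> into the part where the test function vanishes, also for
    \<open>d = -\<infinity>\<close>.\<close>
  obtain a where a: "d \<le> ereal a" "a < b"
  proof -
    obtain a where "d < ereal a" "ereal a < ereal b" using ereal_dense2[OF d] by blast
    thus thesis using that[of a] by simp
  qed
  obtain f where f: "continuous_on UNIV f" "\<And>x. f x \<in> {0..1}"
    "\<And>x. x \<le> ereal a \<Longrightarrow> f x = 0" "\<And>x. x \<ge> ereal b \<Longrightarrow> f x = (1::real)"
    using ereal_test_function[OF a(2)] by metis
  have "bounded (range f)"
    using f(2) by (intro boundedI[of _ 1]) (auto simp: image_iff)
  hence "(\<lambda>l. \<integral>\<omega>. f (Y l (R l \<omega>)) \<partial>M l) \<longlonglongrightarrow> f d"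
    using conv f(1) unfolding converges_in_distribution_to_const_def by blast
  hence lim: "(\<lambda>l. \<integral>\<omega>. f (Y l (R l \<omega>)) \<partial>M l) \<longlonglongrightarrow> 0" using f(3)[OF a(1)] by simp
  show ?thesis
  proof (rule tendsto_sandwich[OF _ _ tendsto_const lim])
    show "\<forall>\<^sub>F l in sequentially. \<P>(\<omega> in M l. Y l (R l \<omega>) \<ge> ereal b)
        \<le> (\<integral>\<omega>. f (Y l (R l \<omega>)) \<partial>M l)"
      using RS
    proof eventually_elim
      case (elim l)
      show ?case
        by (rule random_subset_integral_ge_prob[OF elim, where f = "\<lambda>x. f (Y l x)"])
           (use f in auto)
    qed
  qed simp
qed

text \<open>Negation is continuous on \<open>ereal\<close> and swaps the tails, so the upper tail
  bound applies to \<open>- Y\<close> and \<open>- d\<close>.\<close>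

lemma converges_in_distribution_prob_le:
  assumes conv: "converges_in_distribution_to_const M (\<lambda>l \<omega>. Y l (R l \<omega>)) (d :: ereal)"
    and RS: "\<forall>\<^sub>F l in sequentially. random_subset (M l) (B l) (R l)"
    and d: "ereal a < d"
  shows "(\<lambda>l. \<P>(\<omega> in M l. Y l (R l \<omega>) \<le> ereal a)) \<longlonglongrightarrow> 0"
proof -
  have "converges_in_distribution_to_const M (\<lambda>l \<omega>. - Y l (R l \<omega>)) (- d)"
    unfolding converges_in_distribution_to_const_def
  proof (intro allI impI)
    fix f :: "ereal \<Rightarrow> real"
    assume f: "continuous_on UNIV f" "bounded (range f)"
    have "continuous_on UNIV (\<lambda>x::ereal. f (- x))"
      by (rule continuous_on_compose2[OF f(1)]) (auto intro!: continuous_intros)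
    moreover have "bounded (range (\<lambda>x::ereal. f (- x)))"
      using f(2) by (rule bounded_subset) auto
    ultimately show "(\<lambda>l. \<integral>\<omega>. f (- Y l (R l \<omega>)) \<partial>M l) \<longlonglongrightarrow> f (- d)"
      using conv unfolding converges_in_distribution_to_const_def by blast
  qed
  moreover have "- d < ereal (- a)" using d by (cases d) auto
  ultimately have "(\<lambda>l. \<P>(\<omega> in M l. - Y l (R l \<omega>) \<ge> ereal (- a))) \<longlonglongrightarrow> 0"
    using converges_in_distribution_prob_ge[where Y = "\<lambda>l x. - Y l x", OF _ RS] by blast
  moreover have "- x \<ge> ereal (- a) \<longleftrightarrow> x \<le> ereal a" for x
    by (cases x) auto
  ultimately show ?thesis by simp
qed

section \<open>Counting k-element sets: independent sets, and sets containing given elements\<close>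

section \<open>Families of k-element subsets\<close>

text \<open>These are the independent \<open>k\<close>-sets of the directed graph with an edge from
  \<open>x\<close> to each element of \<open>H x\<close>. The restriction
  \<open>x \<noteq> y\<close> discards loops: in the application every \<open>x\<close> lies in its
  own \<open>H x\<close>.\<close>

definition hit_free :: "'b set \<Rightarrow> ('b \<Rightarrow> 'b set) \<Rightarrow> nat \<Rightarrow> 'b set set" where
  "hit_free B H k = {A. A \<subseteq> B \<and> card A = k \<and> (\<forall>x\<in>A. \<forall>y\<in>A. x \<noteq> y \<longrightarrow> y \<notin> H x)}"

lemma finite_hit_free: "finite B \<Longrightarrow> finite (hit_free B H k)"
  by (rule finite_subset[of _ "Pow B"]) (auto simp: hit_free_def)

text \<open>In a hit-free set the sets \<open>H x\<close> are disjoint, so every new element has to avoid at least \<open>k * s\<close>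
  elements.\<close>

lemma card_hit_free_Suc_le:
  assumes B: "finite B" and H: "\<And>x. x \<in> B \<Longrightarrow> H x \<subseteq> B" "\<And>x. x \<in> B \<Longrightarrow> s \<le> card (H x)"
    and disj: "\<And>x y. x \<in> B \<Longrightarrow> y \<in> B \<Longrightarrow> x \<notin> H y \<Longrightarrow> y \<notin> H x \<Longrightarrow> H x \<inter> H y = {}"
  shows "Suc k * card (hit_free B H (Suc k)) \<le> card (hit_free B H k) * (card B - k * s)"
proof -
  \<comment> \<open>Double counting of the pairs \<open>(A, x)\<close> with
    \<open>x \<in> A\<close>: deleting \<open>x\<close> leaves a hit-free \<open>k\<close>-set all
    of whose sets \<open>H a\<close> miss \<open>x\<close>.\<close>
  let ?S = "SIGMA A:hit_free B H (Suc k). A"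
  let ?T = "SIGMA A:hit_free B H k. B - (\<Union>a\<in>A. H a)"
  let ?f = "\<lambda>(A, x). (A - {x}, x)"
  have fin: "finite A" if "A \<in> hit_free B H j" for A j
    using that B by (auto simp: hit_free_def intro: finite_subset)
  have "?f ` ?S \<subseteq> ?T"
  proof
    fix z assume "z \<in> ?f ` ?S"
    then obtain A x where A: "A \<in> hit_free B H (Suc k)" "x \<in> A" "z = (A - {x}, x)" by auto
    have "card (A - {x}) = k" using A fin[OF A(1)] by (auto simp: hit_free_def)
    thus "z \<in> ?T" using A by (auto simp: hit_free_def)
  qed
  moreover have "inj_on ?f ?S" by (auto simp: inj_on_def)
  ultimately have "card ?S \<le> card ?T"
    using finite_hit_free[OF B] B by (intro card_inj_on_le[of ?f]) auto
  also have "card ?S = (\<Sum>A\<in>hit_free B H (Suc k). card A)"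
    using finite_hit_free[OF B] fin by (subst card_SigmaI) auto
  also have "\<dots> = (\<Sum>A\<in>hit_free B H (Suc k). Suc k)"
    by (intro sum.cong) (auto simp: hit_free_def)
  also have "\<dots> = Suc k * card (hit_free B H (Suc k))" by simp
  also have "card ?T = (\<Sum>A\<in>hit_free B H k. card (B - (\<Union>a\<in>A. H a)))"
    using finite_hit_free[OF B] B by (subst card_SigmaI) auto
  also have "\<dots> \<le> (\<Sum>A\<in>hit_free B H k. card B - k * s)"
  proof (intro sum_mono)
    fix A assume A: "A \<in> hit_free B H k"
    have AB: "A \<subseteq> B" "card A = k" using A by (auto simp: hit_free_def)
    have finH: "finite (H x)" if "x \<in> A" for x
      using H(1)[of x] that AB B finite_subset by blast
    have "k * s = (\<Sum>a\<in>A. s)" using AB by simp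
    also have "\<dots> \<le> (\<Sum>a\<in>A. card (H a))" using AB H(2) by (intro sum_mono) auto
    also have "\<dots> = card (\<Union>a\<in>A. H a)"
    proof (rule card_UN_disjoint[symmetric])
      show "\<forall>i\<in>A. \<forall>j\<in>A. i \<noteq> j \<longrightarrow> H i \<inter> H j = {}"
      proof (intro ballI impI)
        fix x y assume "x \<in> A" "y \<in> A" "x \<noteq> y"
        thus "H x \<inter> H y = {}"
          using A AB by (intro disj) (auto simp: hit_free_def)
      qed
    qed (use fin[OF A] finH in auto)
    finally have "k * s \<le> card (\<Union>a\<in>A. H a)" .
    moreover have "(\<Union>a\<in>A. H a) \<subseteq> B" using AB H(1) by auto
    ultimately show "card (B - (\<Union>a\<in>A. H a)) \<le> card B - k * s"
      using B by (subst card_Diff_subset) (auto intro: finite_subset)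
  qed
  also have "\<dots> = card (hit_free B H k) * (card B - k * s)" by simp
  finally show ?thesis .
qed

text \<open>The recursion is compared with
  \<open>Suc k * (N choose Suc k) = (N - k) * (N choose k)\<close>. Passing from \<open>k\<close> to
  \<open>Suc k\<close> multiplies the proportion by at most \<open>exp (- k * (s - 1) / N)\<close>,
  and the numbers below \<open>k\<close> add up to \<open>k * (k - 1) / 2\<close>.\<close>

lemma card_hit_free_le:
  assumes B: "finite B" and H: "\<And>x. x \<in> B \<Longrightarrow> H x \<subseteq> B" "\<And>x. x \<in> B \<Longrightarrow> s \<le> card (H x)"
    and disj: "\<And>x y. x \<in> B \<Longrightarrow> y \<in> B \<Longrightarrow> x \<notin> H y \<Longrightarrow> y \<notin> H x \<Longrightarrow> H x \<inter> H y = {}"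
    and s: "s \<ge> 1"
  shows "real (card (hit_free B H k))
    \<le> exp (- (real k * (real k - 1) * (real s - 1) / (2 * real (card B)))) * real (card B choose k)"
proof (induction k)
  case 0
  have "hit_free B H 0 \<subseteq> {{}}"
    using B by (auto simp: hit_free_def dest: finite_subset)
  hence "card (hit_free B H 0) \<le> 1"
    using card_mono[of "{{}}" "hit_free B H 0"] by simp
  thus ?case by simp
next
  case (Suc k)
  define N where "N = card B"
  let ?e = "\<lambda>k. exp (- (real k * (real k - 1) * (real s - 1) / (2 * real N)))"
  let ?h = "\<lambda>k. real (card (hit_free B H k))"
  show ?case
  proof (cases "Suc k \<le> N")
    case False
    have "hit_free B H (Suc k) = {}"
    proof (rule ccontr)
      assume "hit_free B H (Suc k) \<noteq> {}"
      then obtain A where "A \<subseteq> B" "card A = Suc k" by (auto simp: hit_free_def)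
      thus False using False card_mono[OF B, of A] by (simp add: N_def)
    qed
    thus ?thesis by simp
  next
    case True
    \<comment> \<open>Truncated subtraction is harmless: once \<open>k * s\<close> exceeds
      \<open>N\<close>, the left-hand side is 0.\<close>
    have step: "real (N - k * s) \<le> (real N - real k) * exp (- (real k * (real s - 1) / real N))"
    proof (cases "k * s \<le> N")
      case ks: True
      have "real (N - k * s) = real N - real k * real s"
        using ks by (simp add: of_nat_diff)
      \<comment> \<open>The added nonnegative summand completes the product
        \<open>(N - k) * (1 - k * (s - 1) / N)\<close>.\<close>
      also have "\<dots> \<le> real N - real k * real s + (real k)\<^sup>2 * (real s - 1) / real N"
        using s by simp
      also have "\<dots> = (real N - real k) * (1 - real k * (real s - 1) / real N)"
        using True by (simp add: field_simps power2_eq_square)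
      also have "\<dots> \<le> (real N - real k) * exp (- (real k * (real s - 1) / real N))"
        using True exp_ge_add_one_self[of "- (real k * (real s - 1) / real N)"]
        by (intro mult_left_mono) auto
      finally show ?thesis .
    qed (use True in simp)
    have "Suc k * (N choose Suc k) = (N - k) * (N choose k)"
      using binomial_absorption[of k N] binomial_absorb_comp[of N k] by simp
    hence "real (Suc k * (N choose Suc k)) = real ((N - k) * (N choose k))" by (rule arg_cong)
    hence choose: "real (Suc k) * real (N choose Suc k) = (real N - real k) * real (N choose k)"
      using True by (simp add: of_nat_diff algebra_simps)
    have "real (Suc k) * ?h (Suc k) \<le> ?h k * real (N - k * s)"
      using card_hit_free_Suc_le[where k = k, OF B H disj]
      unfolding N_def of_nat_mult[symmetric] of_nat_le_iff .
    also have "\<dots> \<le> (?e k * real (N choose k))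
        * ((real N - real k) * exp (- (real k * (real s - 1) / real N)))"
      using Suc step by (intro mult_mono) (auto simp: N_def)
    also have "\<dots> = (?e k * exp (- (real k * (real s - 1) / real N)))
        * ((real N - real k) * real (N choose k))"
      by (simp add: mult_ac)
    also have "?e k * exp (- (real k * (real s - 1) / real N)) = ?e (Suc k)"
      using True by (simp add: exp_add[symmetric] field_simps)
    also have "?e (Suc k) * ((real N - real k) * real (N choose k))
        = real (Suc k) * (?e (Suc k) * real (N choose Suc k))"
      unfolding choose[symmetric] by (simp add: mult_ac)
    finally have "?h (Suc k) \<le> ?e (Suc k) * real (N choose Suc k)"
      by (rule mult_left_le_imp_le) simp
    thus ?thesis by (simp add: N_def)
  qed
qed

lemma card_supersets_le:
  assumes "finite B" "T \<subseteq> B" "card T \<le> k"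
  shows "card {r. r \<subseteq> B \<and> card r = k \<and> T \<subseteq> r} \<le> (card B - card T) choose (k - card T)"
proof -
  have finT: "finite T" using assms finite_subset by blast
  have "card {r. r \<subseteq> B \<and> card r = k \<and> T \<subseteq> r}
      \<le> card {r. r \<subseteq> B - T \<and> card r = k - card T}"
  proof (rule card_inj_on_le[of "\<lambda>r. r - T"])
    show "inj_on (\<lambda>r. r - T) {r. r \<subseteq> B \<and> card r = k \<and> T \<subseteq> r}"
      by (auto simp: inj_on_def)
    show "(\<lambda>r. r - T) ` {r. r \<subseteq> B \<and> card r = k \<and> T \<subseteq> r}
        \<subseteq> {r. r \<subseteq> B - T \<and> card r = k - card T}"
      using finT by (auto simp: card_Diff_subset)
    show "finite {r. r \<subseteq> B - T \<and> card r = k - card T}"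
      using assms by (auto intro: rev_finite_subset[of "Pow B"])
  qed
  also have "\<dots> = (card B - card T) choose (k - card T)"
    using assms finT by (simp add: n_subsets card_Diff_subset)
  finally show ?thesis .
qed

lemma card_supersets_singleton_le:
  assumes "finite B" "x \<in> B"
  shows "real (card {r. r \<subseteq> B \<and> card r = k \<and> x \<in> r})
    \<le> real k / real (card B) * real (card B choose k)"
proof (cases k)
  case 0
  have *: "{r. r \<subseteq> B \<and> card r = k \<and> x \<in> r} = {}"
    using assms 0 by (auto dest: finite_subset)
  show ?thesis unfolding * by simp
next
  case (Suc j)
  have N: "card B > 0" using assms by (auto simp: card_gt_0_iff)
  have "card {r. r \<subseteq> B \<and> card r = k \<and> {x} \<subseteq> r} \<le> (card B - 1) choose j"
    using card_supersets_le[of B "{x}" k] assms Suc by simp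
  hence "real (card {r. r \<subseteq> B \<and> card r = k \<and> x \<in> r}) \<le> real ((card B - 1) choose j)"
    by simp
  also have "\<dots> = real k / real (card B) * real (card B choose k)"
  proof -
    have "real (k * (card B choose k)) = real (card B * ((card B - 1) choose j))"
      using binomial_absorption[of j "card B"] Suc by simp
    thus ?thesis using N by (simp add: field_simps)
  qed
  finally show ?thesis .
qed

text \<open>Absorption used twice gives the factor \<open>k * (k - 1) / (N * (N - 1))\<close>, which
  is at most \<open>(k / N)\<^sup>2\<close> because \<open>k \<le> N\<close>.\<close>

lemma card_supersets_pair_le:
  assumes "finite B" "x \<in> B" "y \<in> B" "x \<noteq> y" "k \<le> card B"
  shows "real (card {r. r \<subseteq> B \<and> card r = k \<and> x \<in> r \<and> y \<in> r})
    \<le> (real k / real (card B))\<^sup>2 * real (card B choose k)"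
proof (cases "k \<ge> 2")
  case False
  have le: "card {x, y} \<le> card r" if "r \<subseteq> B" "x \<in> r" "y \<in> r" for r
    using that assms(1) by (intro card_mono) (auto intro: finite_subset)
  have *: "{r. r \<subseteq> B \<and> card r = k \<and> x \<in> r \<and> y \<in> r} = {}"
    using assms(4) False by (auto dest: le)
  show ?thesis unfolding * by simp
next
  case True
  define j where "j = k - 2"
  have k: "k = Suc (Suc j)" using True by (simp add: j_def)
  define N where "N = card B"
  have N: "N \<ge> 2" using True assms by (simp add: N_def)
  have "card {r. r \<subseteq> B \<and> card r = k \<and> {x, y} \<subseteq> r} \<le> (N - 2) choose j"
    using card_supersets_le[of B "{x, y}" k] assms True by (simp add: N_def j_def numeral_2_eq_2)
  hence "real (card {r. r \<subseteq> B \<and> card r = k \<and> x \<in> r \<and> y \<in> r}) \<le> real ((N - 2) choose j)"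
    by simp
  also have "\<dots> = (real k - 1) / (real N - 1) * (real k / real N) * real (N choose k)"
  proof -
    have "real (k * (N choose k)) = real (N * ((N - 1) choose Suc j))"
      using binomial_absorption[of "Suc j" N] k by simp
    moreover have "real (Suc j * ((N - 1) choose Suc j)) = real ((N - 1) * ((N - 2) choose j))"
      using binomial_absorption[of j "N - 1"] N by (simp add: numeral_2_eq_2)
    ultimately have "real k * real (N choose k) = real N * real ((N - 1) choose Suc j)"
      "(real k - 1) * real ((N - 1) choose Suc j) = (real N - 1) * real ((N - 2) choose j)"
      using N k by (auto simp: of_nat_diff algebra_simps)
    hence "(real k - 1) * (real k * real (N choose k)) = real N * ((real N - 1) * real ((N - 2) choose j))"
      by simp
    thus ?thesis using N by (simp add: field_simps)
  qed
  also have "\<dots> \<le> (real k / real N) * (real k / real N) * real (N choose k)"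
    using N True assms(5) by (intro mult_right_mono) (auto simp: N_def field_simps)
  finally show ?thesis by (simp add: N_def power2_eq_square)
qed

section \<open>Inversion and rotation of words; growth of the number of words at rate 2m - 1\<close>

section \<open>Counting reduced words\<close>

lemma inv_letter_inv_letter [simp]: "inv_letter (inv_letter x) = x"
  by (simp add: inv_letter_def)

lemma inv_letter_neq [simp]: "inv_letter x \<noteq> x" "x \<noteq> inv_letter x"
  by (auto simp: inv_letter_def prod_eq_iff)

lemma inv_letter_in_letters [simp]: "inv_letter x \<in> letters m \<longleftrightarrow> x \<in> letters m"
  by (cases x) (auto simp: inv_letter_def letters_def)

lemma length_inv_word [simp]: "length (inv_word w) = length w"
  by (simp add: inv_word_def)

lemma inv_word_inv_word [simp]: "inv_word (inv_word w) = w"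
  by (simp add: inv_word_def rev_map comp_def)

lemma finite_letters [simp]: "finite (letters m)"
  by (simp add: letters_def)

lemma card_letters: "card (letters m) = 2 * m"
  by (simp add: letters_def)

lemma set_inv_word_subset: "set w \<subseteq> letters m \<Longrightarrow> set (inv_word w) \<subseteq> letters m"
  by (auto simp: inv_word_def)

lemma reduced_inv_word:
  assumes "reduced w"
  shows "reduced (inv_word w)"
proof -
  have "successively (\<lambda>x y. y \<noteq> inv_letter x) (map inv_letter (rev w))"
    using assms unfolding reduced_def
    by (auto simp: successively_map elim!: successively_mono)
  thus ?thesis by (simp add: reduced_def inv_word_def rev_map)
qed

lemma cyclically_reduced_inv_word:
  assumes "cyclically_reduced w"
  shows "cyclically_reduced (inv_word w)"
proof (cases "w = []")
  case False
  have "last (inv_word w) = inv_letter (hd w)" "hd (inv_word w) = inv_letter (last w)"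
    using False by (auto simp: inv_word_def last_rev hd_rev hd_map last_map)
  thus ?thesis using assms False reduced_inv_word[of w]
    by (auto simp: cyclically_reduced_def)
qed (use assms in \<open>simp add: inv_word_def\<close>)

lemma cyclically_reduced_rotate1:
  assumes "cyclically_reduced w"
  shows "cyclically_reduced (rotate1 w)"
proof (cases w)
  case (Cons x xs)
  show ?thesis
  proof (cases "xs = []")
    case False
    hence "successively (\<lambda>x y. y \<noteq> inv_letter x) xs" "hd xs \<noteq> inv_letter x"
        "last xs \<noteq> inv_letter x"
      using assms unfolding Cons cyclically_reduced_def reduced_def
      by (auto simp: successively_Cons)
    hence "successively (\<lambda>x y. y \<noteq> inv_letter x) (xs @ [x])" "x \<noteq> inv_letter (hd xs)"
      using False by (auto simp: successively_append_iff)
    thus ?thesis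
      using False by (simp add: Cons cyclically_reduced_def reduced_def)
  qed (use assms Cons in simp)
qed (use assms in simp)

lemma cyclically_reduced_rotate: "cyclically_reduced w \<Longrightarrow> cyclically_reduced (rotate n w)"
  by (induction n) (auto simp: cyclically_reduced_rotate1)

text \<open>Reducedness is not cyclic here: unlike the cyclically reduced words, this class is
  closed under taking prefixes and suffixes.\<close>

definition red_words :: "nat \<Rightarrow> nat \<Rightarrow> word set" where
  "red_words m k = {w. set w \<subseteq> letters m \<and> reduced w \<and> length w = k}"

definition orient :: "bool \<Rightarrow> word \<Rightarrow> word" where
  "orient b r = (if b then r else inv_word r)"

lemma length_orient [simp]: "length (orient b r) = length r"
  by (simp add: orient_def)

lemma orient_orient [simp]: "orient b (orient b r) = r"
  by (simp add: orient_def)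

lemma occurs_at_orient:
  "occurs_at p r b i \<longleftrightarrow> i < length r \<and> prefix p (rotate i (orient b r))"
  by (simp add: occurs_at_def orient_def)

lemma finite_red_words [simp]: "finite (red_words m k)"
  using finite_lists_length_eq[OF finite_letters, of m k]
  by (rule rev_finite_subset) (auto simp: red_words_def)

lemma finite_cyc_words [simp]: "finite (cyc_words m l)"
  using finite_lists_length_le[OF finite_letters, of m l]
  by (rule rev_finite_subset) (auto simp: cyc_words_def)

lemma rotate_orient_in_red_words:
  assumes "r \<in> cyc_words m l"
  shows "rotate i (orient b r) \<in> red_words m (length r)"
proof -
  have "cyclically_reduced (rotate i (orient b r))"
    using assms by (auto simp: cyc_words_def orient_def
        intro!: cyclically_reduced_rotate cyclically_reduced_inv_word)
  moreover have "set (rotate i (orient b r)) \<subseteq> letters m"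
    using assms set_inv_word_subset by (auto simp: cyc_words_def orient_def)
  ultimately show ?thesis by (simp add: red_words_def cyclically_reduced_def)
qed

lemma drop_in_red_words: "w \<in> red_words m k \<Longrightarrow> drop n w \<in> red_words m (k - n)"
  using set_drop_subset[of n w]
  by (auto simp: red_words_def reduced_def)
     (metis append_take_drop_id successively_append_iff)

lemma take_in_red_words: "w \<in> red_words m k \<Longrightarrow> n \<le> k \<Longrightarrow> take n w \<in> red_words m n"
  using set_take_subset[of n w]
  by (auto simp: red_words_def reduced_def)
     (metis append_take_drop_id successively_append_iff)

definition extensions :: "nat \<Rightarrow> word \<Rightarrow> nat \<Rightarrow> word set" where
  "extensions m p n = {w \<in> red_words m (length p + n). prefix p w}"

lemma finite_extensions [simp]: "finite (extensions m p n)"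
  by (simp add: extensions_def)

lemma reduced_snoc:
  "w \<noteq> [] \<Longrightarrow> reduced (w @ [x]) \<longleftrightarrow> reduced w \<and> x \<noteq> inv_letter (last w)"
  by (auto simp: reduced_def successively_append_iff)

text \<open>After a nonempty reduced word exactly one letter is forbidden, the inverse of the last
  one, so each new letter has \<open>2 * m - 1\<close> choices.\<close>

lemma card_extensions:
  assumes "p \<in> red_words m k" "p \<noteq> []"
  shows "card (extensions m p n) = (2 * m - 1) ^ n"
proof (induction n)
  case 0
  have "extensions m p 0 = {p}"
    using assms by (auto simp: extensions_def red_words_def elim!: prefixE)
  thus ?case by simp
next
  case (Suc n)
  let ?S = "SIGMA w:extensions m p n. letters m - {inv_letter (last w)}"
  have ne: "w \<noteq> []" if "w \<in> extensions m p n" for w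
    using that assms by (auto simp: extensions_def)
  have "extensions m p (Suc n) = (\<lambda>(w, x). w @ [x]) ` ?S"
  proof (intro equalityI subsetI)
    fix u assume u: "u \<in> extensions m p (Suc n)"
    then obtain w x where ux: "u = w @ [x]"
      by (cases u rule: rev_cases) (auto simp: extensions_def red_words_def)
    have lw: "length w = length p + n" using u ux by (auto simp: extensions_def red_words_def)
    have "prefix p w" using u lw unfolding ux
      by (auto simp: extensions_def prefix_def append_eq_append_conv2 Cons_eq_append_conv)
    moreover have "w \<noteq> []" using lw assms by auto
    ultimately have "w \<in> extensions m p n" "x \<in> letters m - {inv_letter (last w)}"
      using u lw unfolding ux by (auto simp: extensions_def red_words_def reduced_snoc)
    thus "u \<in> (\<lambda>(w, x). w @ [x]) ` ?S" using ux by force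
  next
    fix u assume "u \<in> (\<lambda>(w, x). w @ [x]) ` ?S"
    then obtain w x where "u = w @ [x]" "w \<in> extensions m p n" "x \<in> letters m"
        "x \<noteq> inv_letter (last w)" by auto
    thus "u \<in> extensions m p (Suc n)" using ne[of w]
      by (auto simp: extensions_def red_words_def reduced_snoc)
  qed
  hence "card (extensions m p (Suc n)) = card ?S"
    by (simp add: card_image inj_on_def)
  also have "\<dots> = (\<Sum>w\<in>extensions m p n. card (letters m - {inv_letter (last w)}))"
    by (simp add: card_SigmaI)
  also have "\<dots> = (\<Sum>w\<in>extensions m p n. 2 * m - 1)"
  proof (intro sum.cong refl)
    fix w assume w: "w \<in> extensions m p n"
    hence "last w \<in> letters m"
      using ne[OF w] last_in_set[of w] by (auto simp: extensions_def red_words_def)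
    thus "card (letters m - {inv_letter (last w)}) = 2 * m - 1"
      by (simp add: card_letters)
  qed
  also have "\<dots> = (2 * m - 1) ^ Suc n"
    by (simp add: Suc)
  finally show ?case .
qed

text \<open>The first letter has \<open>2 * m\<close> choices and each later one
  \<open>2 * m - 1\<close>; the factor 2 absorbs the difference.\<close>

lemma card_red_words_le:
  assumes "m \<ge> 1"
  shows "card (red_words m k) \<le> 2 * (2 * m - 1) ^ k"
proof (cases k)
  case 0
  have "red_words m 0 \<subseteq> {[]}" by (auto simp: red_words_def)
  hence "card (red_words m 0) \<le> card {[] :: word}" by (intro card_mono) auto
  thus ?thesis using 0 by simp
next
  case (Suc n)
  have "red_words m k \<subseteq> (\<Union>x\<in>letters m. extensions m [x] n)"
  proof
    fix w assume w: "w \<in> red_words m k"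
    then obtain x u where "w = x # u" using Suc by (cases w) (auto simp: red_words_def)
    thus "w \<in> (\<Union>x\<in>letters m. extensions m [x] n)"
      using w Suc by (auto simp: extensions_def red_words_def intro!: bexI[of _ x])
  qed
  hence "card (red_words m k) \<le> card (\<Union>x\<in>letters m. extensions m [x] n)"
    by (intro card_mono) auto
  also have "\<dots> \<le> (\<Sum>x\<in>letters m. card (extensions m [x] n))"
    by (intro card_UN_le) auto
  also have "\<dots> = (\<Sum>x\<in>letters m. (2 * m - 1) ^ n)"
    by (intro sum.cong refl card_extensions[of _ _ 1]) (auto simp: red_words_def reduced_def)
  also have "\<dots> = (2 * m) * (2 * m - 1) ^ n" by (simp add: card_letters)
  also have "\<dots> \<le> (2 * (2 * m - 1)) * (2 * m - 1) ^ n"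
    using assms by (intro mult_right_mono) auto
  also have "\<dots> = 2 * (2 * m - 1) ^ k" by (simp add: Suc)
  finally show ?thesis .
qed

text \<open>All letters after \<open>p\<close> except the last one range over the reduced
  extensions. The last letter then closes the word up without cancelling against either neighbour;
  it exists since \<open>2 * m > 2\<close>, and it costs the 1 in the exponent.\<close>

lemma card_cyc_words_prefix_ge:
  assumes "m \<ge> 2" "p \<in> red_words m k" "p \<noteq> []" "k < l"
  shows "(2 * m - 1) ^ (l - k - 1) \<le> card {w \<in> cyc_words m l. prefix p w}"
proof -
  define n where "n = l - k - 1"
  have k: "length p = k" using assms by (simp add: red_words_def)
  have "\<exists>x. x \<in> letters m \<and> x \<noteq> inv_letter (last w) \<and> x \<noteq> inv_letter (hd w)" for w :: word
  proof -
    have "card {inv_letter (last w), inv_letter (hd w)} < card (letters m)"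
      using assms(1) by (simp add: card_letters card_insert_if)
    hence "\<not> letters m \<subseteq> {inv_letter (last w), inv_letter (hd w)}"
      by (meson card_mono finite.intros leD)
    thus ?thesis by blast
  qed
  then obtain f where f: "\<And>w. f w \<in> letters m" "\<And>w. f w \<noteq> inv_letter (last w)"
      "\<And>w. f w \<noteq> inv_letter (hd w)" by metis
  have "(\<lambda>w. w @ [f w]) ` extensions m p n \<subseteq> {w \<in> cyc_words m l. prefix p w}"
  proof
    fix u assume "u \<in> (\<lambda>w. w @ [f w]) ` extensions m p n"
    then obtain w where u: "u = w @ [f w]" and w: "w \<in> extensions m p n" by auto
    have ne: "w \<noteq> []" using w assms by (auto simp: extensions_def)
    show "u \<in> {w \<in> cyc_words m l. prefix p w}"
      using w ne f[of w] k assms(4) unfolding u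
      by (auto simp: extensions_def red_words_def cyc_words_def cyclically_reduced_def
          reduced_snoc n_def)
  qed
  moreover have "inj_on (\<lambda>w. w @ [f w]) (extensions m p n)"
    by (auto simp: inj_on_def)
  ultimately have "card (extensions m p n) \<le> card {w \<in> cyc_words m l. prefix p w}"
    by (intro card_inj_on_le) auto
  thus ?thesis using card_extensions[OF assms(2,3)] by (simp add: n_def)
qed

lemma card_cyc_words_ge:
  assumes "m \<ge> 2" "l \<ge> 2"
  shows "(2 * m - 1) ^ (l - 2) \<le> card (cyc_words m l)"
proof -
  have "[(1, True)] \<in> red_words m 1"
    using assms by (auto simp: red_words_def reduced_def letters_def)
  from card_cyc_words_prefix_ge[OF assms(1) this, of l] assms
  have "(2 * m - 1) ^ (l - 2) \<le> card {w \<in> cyc_words m l. prefix [(1, True)] w}"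
    by (simp add: numeral_2_eq_2)
  also have "\<dots> \<le> card (cyc_words m l)" by (intro card_mono) auto
  finally show ?thesis .
qed

lemma card_cyc_words_le:
  assumes "m \<ge> 1"
  shows "card (cyc_words m l) \<le> 2 * (l + 1) * (2 * m - 1) ^ l"
proof -
  have "cyc_words m l \<subseteq> (\<Union>k\<le>l. red_words m k)"
    by (auto simp: cyc_words_def red_words_def cyclically_reduced_def)
  hence "card (cyc_words m l) \<le> card (\<Union>k\<le>l. red_words m k)"
    by (intro card_mono) auto
  also have "\<dots> \<le> (\<Sum>k\<le>l. card (red_words m k))"
    by (intro card_UN_le) auto
  also have "\<dots> \<le> (\<Sum>k\<le>l. 2 * (2 * m - 1) ^ l)"
  proof (intro sum_mono)
    fix k assume "k \<in> {..l}"
    hence "(2 * m - 1) ^ k \<le> (2 * m - 1) ^ l"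
      using assms by (intro power_increasing) auto
    thus "card (red_words m k) \<le> 2 * (2 * m - 1) ^ l"
      using card_red_words_le[OF assms, of k] by linarith
  qed
  finally show ?thesis by simp
qed

section \<open>A subword occurring twice in one relator forces a block of letters copied from
  earlier ones\<close>

section \<open>Self-overlaps\<close>

text \<open>Because \<open>g\<close> points strictly to the left, the letters of the block can be
  recovered one after another. The word is thus determined by the parts before and after the block,
  which are reduced and contribute a factor 2 each.\<close>

lemma card_determined_block_le:
  assumes m: "m \<ge> 1" and th: "t + h \<le> k"
    and g: "\<And>y. t \<le> y \<Longrightarrow> y < t + h \<Longrightarrow> g y < y"
  shows "card {w \<in> red_words m k. \<forall>y\<in>{t..<t+h}. w ! y = F (w ! g y)}
    \<le> 4 * (2 * m - 1) ^ (k - h)" (is "card ?D \<le> _")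
proof -
  let ?f = "\<lambda>w. (take t w, drop (t + h) w)"
  have "inj_on ?f ?D"
  proof (rule inj_onI)
    fix v w assume v: "v \<in> ?D" and w: "w \<in> ?D" and eq: "?f v = ?f w"
    have len: "length v = k" "length w = k" using v w by (auto simp: red_words_def)
    have "v ! y = w ! y" if "y < k" for y
      using that
    proof (induction y rule: less_induct)
      case (less y)
      consider "y < t" | "t \<le> y" "y < t + h" | "t + h \<le> y" by linarith
      thus ?case
      proof cases
        case 1
        thus ?thesis using eq by (metis nth_take prod.inject)
      next
        case 2
        hence "v ! y = F (v ! g y)" "w ! y = F (w ! g y)" using v w by auto
        thus ?thesis using less g[OF 2] by simp
      next
        case 3
        hence "v ! y = drop (t + h) v ! (y - (t + h))" "w ! y = drop (t + h) w ! (y - (t + h))"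
          using len th by auto
        thus ?thesis using eq by simp
      qed
    qed
    thus "v = w" using len by (intro nth_equalityI) auto
  qed
  moreover have "?f ` ?D \<subseteq> red_words m t \<times> red_words m (k - (t + h))"
    using th by (auto intro: take_in_red_words drop_in_red_words)
  ultimately have "card ?D \<le> card (red_words m t \<times> red_words m (k - (t + h)))"
    by (intro card_inj_on_le) auto
  also have "\<dots> \<le> (2 * (2 * m - 1) ^ t) * (2 * (2 * m - 1) ^ (k - (t + h)))"
    unfolding card_cartesian_product by (intro mult_mono card_red_words_le m) auto
  also have "\<dots> = 4 * (2 * m - 1) ^ (k - h)"
    using th by (simp add: power_add[symmetric])
  finally show ?thesis .
qed

lemma inj_rotate_orient: "inj (\<lambda>r. rotate i (orient b r))"
proof (rule injI)
  fix r s assume eq: "rotate i (orient b r) = rotate i (orient b s)"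
  hence "orient b r = orient b s"
    by (induction i) (auto dest: inj_rotate1[THEN injD])
  thus "r = s" by (metis orient_orient)
qed

text \<open>The flag \<open>b\<close> tells whether the two copies of the block are read in the same direction.\<close>

definition block_copy :: "nat \<Rightarrow> nat \<Rightarrow> nat \<Rightarrow> nat \<Rightarrow> bool \<Rightarrow> word set" where
  "block_copy m k h t b = (if b
     then {w \<in> red_words m k. 0 < t \<and> t + h \<le> k \<and> (\<forall>y\<in>{t..<t+h}. w ! y = w ! (y - t))}
     else {w \<in> red_words m k. h \<le> t \<and> t + h \<le> k \<and>
       (\<forall>y\<in>{t..<t+h}. w ! y = inv_letter (w ! (t + h - 1 - y)))})"

text \<open>The source of a copied letter lies strictly to its left in both cases: a translation by
  \<open>t > 0\<close> moves left, and a reflection with \<open>h \<le> t\<close> sends the block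
  below position \<open>t\<close>.\<close>

lemma card_block_copy_le:
  assumes "m \<ge> 1"
  shows "card (block_copy m k h t b) \<le> 4 * (2 * m - 1) ^ (k - h)"
proof -
  consider "b" "0 < t" "t + h \<le> k" | "\<not> b" "h \<le> t" "t + h \<le> k" | "block_copy m k h t b = {}"
    by (cases "t + h \<le> k"; cases "0 < t"; cases "h \<le> t"; cases b) (auto simp: block_copy_def)
  thus ?thesis
  proof cases
    case 1
    thus ?thesis
      using card_determined_block_le[OF assms 1(3), of "\<lambda>y. y - t" "\<lambda>x. x"]
      by (simp add: block_copy_def)
  next
    case 2
    thus ?thesis
      using card_determined_block_le[OF assms 2(3), of "\<lambda>y. t + h - 1 - y" inv_letter]
      by (simp add: block_copy_def)
  qed simp
qed

text \<open>Exchanging the two occurrences replaces their distance \<open>t\<close> by \<open>k - t\<close>, so \<open>2 * t \<le> k\<close> may be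
  assumed. Keeping only half of \<open>p\<close> then leaves room for the block, even if the occurrences overlap.\<close>

lemma rotate_same_orientation_overlap:
  assumes w: "rotate i1 s \<in> red_words m k" "rotate i2 s \<in> red_words m k"
    and p: "prefix p (rotate i1 s)" "prefix p (rotate i2 s)"
    and i: "i1 < i2" "i2 < k" and h: "h = length p div 2"
  shows "\<exists>i t. i < k \<and> t \<le> k \<and> rotate i s \<in> block_copy m k h t True"
proof -
  have main: "rotate i s \<in> block_copy m k h t True"
    if w: "rotate i s \<in> red_words m k" and p: "prefix p (rotate i s)" "prefix p (rotate t (rotate i s))"
      and t: "0 < t" "2 * t \<le> k" for i t
  proof -
    define w where "w = rotate i s"
    have len: "length w = k" using \<open>rotate i s \<in> _\<close> by (simp add: w_def red_words_def)
    have pk: "length p \<le> k" using prefix_length_le[OF p(1)] len by (simp add: w_def)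
    have "w ! y = w ! (y - t)" if y: "t \<le> y" "y < t + h" for y
    proof -
      have x: "y - t < length p" using y h by auto
      have "p ! (y - t) = w ! (y - t)"
        using p(1) x by (auto simp: w_def[symmetric] prefix_def nth_append)
      moreover have "p ! (y - t) = rotate t w ! (y - t)"
        using p(2) x by (auto simp: w_def[symmetric] prefix_def nth_append)
      moreover have "rotate t w ! (y - t) = w ! y"
        using y t h pk x len by (subst nth_rotate) auto
      ultimately show ?thesis by simp
    qed
    \<comment> \<open>Both \<open>t\<close> and \<open>h\<close> are at most half of
      \<open>k\<close>.\<close>
    moreover have "t + h \<le> k" using t h pk by linarith
    ultimately show ?thesis using w t by (auto simp: block_copy_def w_def)
  qed
  have len: "length s = k" using w by (simp add: red_words_def)
  show ?thesis
  proof (cases "2 * (i2 - i1) \<le> k")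
    case True
    have "rotate (i2 - i1) (rotate i1 s) = rotate i2 s" using i by (simp add: rotate_rotate)
    thus ?thesis using main[OF w(1) p(1), of "i2 - i1"] p(2) True i
      by (intro exI[of _ i1] exI[of _ "i2 - i1"]) auto
  next
    case False
    \<comment> \<open>Going on from \<open>i2\<close> past the end of the cyclic word reaches
      \<open>i1\<close> after \<open>k - (i2 - i1)\<close> steps, less than half a turn in this
      case.\<close>
    have "rotate (k - (i2 - i1)) (rotate i2 s) = rotate (k + i1) s"
      using i by (simp add: rotate_rotate)
    also have "\<dots> = rotate i1 s" using len by (metis mod_add_self1 rotate_conv_mod)
    finally show ?thesis using main[OF w(2) p(2), of "k - (i2 - i1)"] p(1) False i
      by (intro exI[of _ i2] exI[of _ "k - (i2 - i1)"]) auto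
  qed
qed

lemma reduced_nth_Suc: "reduced w \<Longrightarrow> Suc i < length w \<Longrightarrow> w ! Suc i \<noteq> inv_letter (w ! i)"
  unfolding reduced_def by (simp add: successively_conv_nth)

lemma inv_word_nth: "i < length w \<Longrightarrow> inv_word w ! i = inv_letter (w ! (length w - Suc i))"
  by (simp add: inv_word_def rev_nth)

text \<open>An occurrence in the inverse word is a reflection \<open>x \<mapsto> s - x\<close> of
  positions combined with inversion of letters. Since \<open>p\<close> cannot reach the centre of
  the reflection, its first \<open>h\<close> letters and their mirror image are disjoint
  blocks.\<close>

lemma rotate_opposite_orientation_overlap:
  assumes w: "w \<in> red_words m k" and p: "prefix p w" "prefix p (rotate i (inv_word w))"
    and i: "i < k" and h: "h = length p div 2"
  shows "\<exists>t\<le>k. w \<in> block_copy m k h t False"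
proof -
  have len: "length w = k" and red: "reduced w" using w by (auto simp: red_words_def)
  \<comment> \<open>The position of \<open>w\<close> at which the backward reading starts; up to
    \<open>x = s\<close> it does not wrap around.\<close>
  define s where "s = k - 1 - i"
  have flip: "w ! x = inv_letter (w ! (s - x))" if "x < length p" "x \<le> s" for x
  proof -
    have "x < k" using that prefix_length_le[OF p(1)] len by auto
    have "w ! x = rotate i (inv_word w) ! x"
      using p that by (auto simp: prefix_def nth_append)
    also have "\<dots> = inv_letter (w ! (s - x))"
      using that i len \<open>x < k\<close> by (subst nth_rotate) (auto simp: inv_word_nth s_def)
    finally show ?thesis .
  qed
  \<comment> \<open>Otherwise the centre of the reflection \<open>x \<mapsto> s - x\<close> exhibits a letter that is its own inverse or
    a cancelling pair.\<close>
  have "length p \<le> s div 2"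
  proof (rule ccontr)
    assume "\<not> ?thesis"
    hence x: "w ! (s div 2) = inv_letter (w ! (s - s div 2))" by (intro flip) auto
    show False
    proof (cases "even s")
      case True
      hence "s - s div 2 = s div 2" by auto
      thus False using x by simp
    next
      case False
      hence "s - s div 2 = Suc (s div 2)" by (auto elim!: oddE)
      moreover have "s < length w" using i len by (simp add: s_def)
      hence "Suc (s div 2) < length w" using False by (elim oddE) simp
      ultimately show False using x reduced_nth_Suc[OF red] by (metis inv_letter_inv_letter)
    qed
  qed
  hence sh: "length p + length p \<le> s" by linarith
  \<comment> \<open>The block is the mirror image of the first \<open>h\<close> letters, so it ends
    at position \<open>s\<close>.\<close>
  define t where "t = Suc s - h"
  have t: "h \<le> t" "t + h = Suc s" "Suc s \<le> k" using sh h i by (auto simp: t_def s_def)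
  have "w ! y = inv_letter (w ! (t + h - 1 - y))" if "t \<le> y" "y < t + h" for y
  proof -
    \<comment> \<open>The reflection is known only at positions inside \<open>p\<close>, so it is
      applied at \<open>s - y\<close> and then solved for \<open>w ! y\<close>.\<close>
    have "w ! (s - y) = inv_letter (w ! (s - (s - y)))"
      using that t h sh by (intro flip) auto
    moreover have "s - (s - y) = y" using that t by auto
    ultimately show ?thesis using t by simp
  qed
  hence "w \<in> block_copy m k h t False" using w t by (auto simp: block_copy_def)
  moreover have "t \<le> k" using t by linarith
  ultimately show ?thesis by blast
qed

lemma inv_word_rotate: "\<exists>j<length w. inv_word (rotate i w) = rotate j (inv_word w)" if "w \<noteq> []"
proof -
  have "inv_word (rotate i w) = rotate (length w - i mod length w) (inv_word w)"
    using arg_cong[OF rotate_rev[of i "rev (map inv_letter w)"], of rev]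
    by (simp add: inv_word_def rotate_map)
  hence "inv_word (rotate i w) = rotate ((length w - i mod length w) mod length w) (inv_word w)"
    using rotate_conv_mod[of "length w - i mod length w" "inv_word w"] by simp
  thus ?thesis using that by (intro exI[of _ "(length w - i mod length w) mod length w"]) simp
qed

text \<open>Equal directions force different starting points and give a translated block. For
  opposite directions the first occurrence is rotated to the front; the second reading is then a
  rotation of the inverse of that rotated word, and the block is reflected.\<close>

lemma self_overlap:
  assumes r: "r \<in> cyc_words m l" and o1: "occurs_at p r b1 i1" and o2: "occurs_at p r b2 i2"
    and ne: "(b1, i1) \<noteq> (b2, i2)"
  defines "k \<equiv> length r"
  shows "\<exists>b i t c. i < k \<and> t \<le> k \<and> rotate i (orient b r) \<in> block_copy m k (length p div 2) t c"
proof (cases "b1 = b2")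
  case True
  let ?s = "orient b1 r"
  have *: "\<exists>i t. i < k \<and> t \<le> k \<and> rotate i ?s \<in> block_copy m k (length p div 2) t True"
    if "occurs_at p r b1 i" "occurs_at p r b1 j" "i < j" for i j
    by (rule rotate_same_orientation_overlap[where ?i1.0 = i and ?i2.0 = j])
       (use that rotate_orient_in_red_words[OF r] in \<open>auto simp: occurs_at_orient k_def\<close>)
  show ?thesis
  proof (cases "i1 < i2")
    case True
    thus ?thesis using *[of i1 i2] o1 o2 \<open>b1 = b2\<close> by blast
  next
    case False
    hence "i2 < i1" using ne True by auto
    thus ?thesis using *[of i2 i1] o1 o2 True by blast
  qed
next
  case False
  let ?w = "rotate i1 (orient b1 r)"
  have r0: "r \<noteq> []" using r by (auto simp: cyc_words_def)
  obtain j where j: "inv_word ?w = rotate j (inv_word (orient b1 r))"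
    using inv_word_rotate[of "orient b1 r" i1] r0 by (metis length_0_conv length_orient)
  have inv: "inv_word (orient b1 r) = orient b2 r"
    using False by (cases b1) (auto simp: orient_def)
  have wk: "length ?w = k" by (simp add: k_def)
  \<comment> \<open>\<open>n\<close> undoes the rotation by \<open>j\<close>, reduced modulo
    \<open>k\<close>.\<close>
  obtain n where n: "n < k" "orient b2 r = rotate n (inv_word ?w)"
  proof -
    have "rotate (k - j mod k) (rotate j (orient b2 r)) = orient b2 r"
    proof -
      have "k > 0" using r0 by (simp add: k_def)
      hence "j mod k \<le> k" by (simp add: less_imp_le)
      hence "k - j mod k + j = k + (j - j mod k)" by simp
      also have "\<dots> = k * Suc (j div k)" by (simp add: minus_mod_eq_mult_div)
      finally have "(k - j mod k + j) mod k = 0" by simp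
      thus ?thesis by (simp add: rotate_rotate k_def rotate_id)
    qed
    hence "orient b2 r = rotate ((k - j mod k) mod k) (inv_word ?w)"
      using j inv rotate_conv_mod[of "k - j mod k" "inv_word ?w"] wk by simp
    moreover have "(k - j mod k) mod k < k" using r0 by (simp add: k_def)
    ultimately show thesis using that by blast
  qed
  have "rotate i2 (orient b2 r) = rotate ((i2 + n) mod k) (inv_word ?w)"
    unfolding n(2) rotate_rotate using rotate_conv_mod[of "i2 + n" "inv_word ?w"] wk by simp
  hence "prefix p (rotate ((i2 + n) mod k) (inv_word ?w))"
    using o2 by (simp add: occurs_at_orient)
  moreover have "prefix p ?w" "i1 < k" using o1 by (auto simp: occurs_at_orient k_def)
  moreover have "?w \<in> red_words m k" using rotate_orient_in_red_words[OF r] by (simp add: k_def)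
  moreover have "(i2 + n) mod k < k" using n by simp
  ultimately show ?thesis
    using rotate_opposite_orientation_overlap[of ?w m k p "(i2 + n) mod k", OF _ _ _ _ refl] by blast
qed

section \<open>Counting the obstructions: pairs with a common subword, and words with a repeated
  one\<close>

section \<open>Words sharing a long subword\<close>

text \<open>The asymmetry is deliberate: \<open>r1\<close> is the relator for which the subword is
  too long. Fixing the least violating length suffices, because a prefix of an occurring subword
  occurs at the same place.\<close>

definition shared_pairs :: "nat \<Rightarrow> nat \<Rightarrow> real \<Rightarrow> (word \<times> word) set" where
  "shared_pairs m l c = {(r1, r2). r1 \<in> cyc_words m l \<and> r2 \<in> cyc_words m l \<and> r1 \<noteq> r2 \<and>
     (\<exists>p b1 i1 b2 i2. length p = nat \<lceil>c * real (length r1)\<rceil> \<and>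
        occurs_at p r1 b1 i1 \<and> occurs_at p r2 b2 i2)}"

definition self_sharing :: "nat \<Rightarrow> nat \<Rightarrow> real \<Rightarrow> word set" where
  "self_sharing m l c = {r \<in> cyc_words m l.
     \<exists>p b1 i1 b2 i2. length p = nat \<lceil>c * real (length r)\<rceil> \<and>
        occurs_at p r b1 i1 \<and> occurs_at p r b2 i2 \<and> (b1, i1) \<noteq> (b2, i2)}"

text \<open>A piece too long for \<open>r\<close> is cut down to the least violating length. If one
  of its two witnessing occurrences lies in another relator, that relator is paired with
  \<open>r\<close>; otherwise both lie in \<open>r\<close>.\<close>

lemma not_small_cancellation_cases:
  assumes R: "R \<subseteq> cyc_words m l" and "\<not> small_cancellation c R"
  obtains x y where "(x, y) \<in> shared_pairs m l c" "x \<in> R" "y \<in> R"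
    | x where "x \<in> self_sharing m l c" "x \<in> R"
proof -
  obtain p r b i r1 b1 i1 r2 b2 i2 where r: "r \<in> R" "r1 \<in> R" "r2 \<in> R"
    and p: "occurs_at p r b i" "occurs_at p r1 b1 i1" "occurs_at p r2 b2 i2"
    and ne: "(r1, b1, i1) \<noteq> (r2, b2, i2)" and len: "\<not> real (length p) < c * real (length r)"
    using assms(2) unfolding small_cancellation_def piece_def by blast
  define j where "j = nat \<lceil>c * real (length r)\<rceil>"
  have j: "j \<le> length p" using len by (simp add: j_def nat_le_iff ceiling_le_iff)
  have occ: "occurs_at (take j p) r' b' i'" if "occurs_at p r' b' i'" for r' b' i'
    using that take_is_prefix prefix_order.trans unfolding occurs_at_def by blast
  have lj: "length (take j p) = j" using j by simp
  have pair: "(r, s) \<in> shared_pairs m l c"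
    if "s \<in> R" "s \<noteq> r" "occurs_at p s b' i'" for s b' i'
    using that r p(1) R lj occ unfolding shared_pairs_def j_def by blast
  show thesis
  proof (cases "r1 = r \<and> r2 = r")
    case True
    hence "(b1, i1) \<noteq> (b2, i2)" using ne by auto
    hence "r \<in> self_sharing m l c"
      using True r p R lj occ unfolding self_sharing_def j_def by blast
    thus thesis using that(2) r by blast
  next
    case False
    thus thesis using that(1) pair p r by blast
  qed
qed

text \<open>With directions and starting points fixed, \<open>r1\<close> determines the first
  \<open>j\<close> letters of the rotated \<open>r2\<close>, and only the other
  \<open>k2 - j\<close> remain free. The 16 combines four choices of directions with two factors 2
  from counting reduced words.\<close>

lemma card_shared_pairs_length_le:
  assumes m: "m \<ge> 1"
  shows "card {(r1, r2). r1 \<in> cyc_words m l \<and> r2 \<in> cyc_words m l \<and> length r1 = k1 \<and> length r2 = k2 \<and>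
     (\<exists>p b1 i1 b2 i2. length p = j \<and> occurs_at p r1 b1 i1 \<and> occurs_at p r2 b2 i2)}
   \<le> 16 * k1 * k2 * (2 * m - 1) ^ (k1 + (k2 - j))" (is "card ?P \<le> _")
proof -
  define I where "I = (UNIV :: bool set) \<times> {..<k1} \<times> (UNIV :: bool set) \<times> {..<k2}"
  define X where "X = (\<lambda>(b1, i1, b2, i2). {(r1, r2). r1 \<in> cyc_words m l \<and> r2 \<in> cyc_words m l \<and>
    length r1 = k1 \<and> length r2 = k2 \<and>
    take j (rotate i1 (orient b1 r1)) = take j (rotate i2 (orient b2 r2))})"
  have "?P \<subseteq> (\<Union>z\<in>I. X z)"
  proof (clarify)
    fix r1 r2 p b1 i1 b2 i2
    assume *: "r1 \<in> cyc_words m l" "r2 \<in> cyc_words m l" "k1 = length r1" "k2 = length r2"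
      "j = length p" "occurs_at p r1 b1 i1" "occurs_at p r2 b2 i2"
    have "(r1, r2) \<in> X (b1, i1, b2, i2)" "(b1, i1, b2, i2) \<in> I"
      using * by (auto simp: X_def I_def occurs_at_orient prefix_def)
    thus "(r1, r2) \<in> (\<Union>z\<in>I. X z)" by blast
  qed
  moreover have finX: "finite (X z)" for z
    by (rule finite_subset[of _ "cyc_words m l \<times> cyc_words m l"]) (auto simp: X_def)
  moreover have finI: "finite I" by (simp add: I_def)
  ultimately have "card ?P \<le> card (\<Union>z\<in>I. X z)"
    by (intro card_mono) auto
  also have "\<dots> \<le> (\<Sum>z\<in>I. card (X z))" by (rule card_UN_le[OF finI])
  also have "\<dots> \<le> (\<Sum>z\<in>I. 4 * (2 * m - 1) ^ (k1 + (k2 - j)))"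
  proof (intro sum_mono)
    fix z assume "z \<in> I"
    obtain b1 i1 b2 i2 where z: "z = (b1, i1, b2, i2)" by (cases z) auto
    let ?w1 = "\<lambda>r. rotate i1 (orient b1 r)" and ?w2 = "\<lambda>r. rotate i2 (orient b2 r)"
    let ?f = "\<lambda>(r1, r2). (?w1 r1, drop j (?w2 r2))"
    have "inj_on ?f (X z)"
    proof (rule inj_onI, clarify)
      fix r1 r2 s1 s2
      assume *: "(r1, r2) \<in> X z" "(s1, s2) \<in> X z" "?w1 r1 = ?w1 s1"
        "drop j (?w2 r2) = drop j (?w2 s2)"
      have 1: "r1 = s1" using injD[OF inj_rotate_orient *(3)] .
      have "take j (?w2 r2) = take j (?w2 s2)" using * 1 by (simp add: X_def z)
      hence "?w2 r2 = ?w2 s2" using *(4) by (metis append_take_drop_id)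
      hence "r2 = s2" by (rule injD[OF inj_rotate_orient])
      thus "r1 = s1 \<and> r2 = s2" using 1 by simp
    qed
    moreover have "?f ` X z \<subseteq> red_words m k1 \<times> red_words m (k2 - j)"
      using rotate_orient_in_red_words
      by (auto simp: X_def z intro!: drop_in_red_words)
    ultimately have "card (X z) \<le> card (red_words m k1 \<times> red_words m (k2 - j))"
      by (intro card_inj_on_le) auto
    also have "\<dots> \<le> (2 * (2 * m - 1) ^ k1) * (2 * (2 * m - 1) ^ (k2 - j))"
      unfolding card_cartesian_product by (intro mult_mono card_red_words_le m) auto
    finally show "card (X z) \<le> 4 * (2 * m - 1) ^ (k1 + (k2 - j))"
      by (simp add: power_add)
  qed
  also have "\<dots> = 16 * k1 * k2 * (2 * m - 1) ^ (k1 + (k2 - j))"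
    by (simp add: I_def card_cartesian_product)
  finally show ?thesis .
qed

text \<open>The exponent is at most \<open>(1 - c) * k1 + k2\<close>, which is largest for
  \<open>k1 = k2 = l\<close>; there are \<open>l ^ 2\<close> pairs of lengths.\<close>

lemma card_shared_pairs_le:
  assumes m: "m \<ge> 1" and c: "0 < c" "c < 1"
  shows "real (card (shared_pairs m l c))
    \<le> 16 * real l ^ 4 * real (2 * m - 1) powr ((2 - c) * real l)"
proof -
  define q where "q = 2 * m - 1"
  have q: "q \<ge> 1" using m by (simp add: q_def)
  define j where "j k = nat \<lceil>c * real k\<rceil>" for k
  define Y where "Y = (\<lambda>(k1, k2). {(r1, r2). r1 \<in> cyc_words m l \<and> r2 \<in> cyc_words m l \<and>
     length r1 = k1 \<and> length r2 = k2 \<and> (\<exists>p b1 i1 b2 i2. length p = j k1 \<and>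
     occurs_at p r1 b1 i1 \<and> occurs_at p r2 b2 i2)})"
  have finY: "finite (Y z)" for z
    by (rule finite_subset[of _ "cyc_words m l \<times> cyc_words m l"]) (auto simp: Y_def)
  have sub: "shared_pairs m l c \<subseteq> (\<Union>z\<in>{1..l}\<times>{1..l}. Y z)"
  proof clarify
    fix r1 r2 assume "(r1, r2) \<in> shared_pairs m l c"
    hence "(r1, r2) \<in> Y (length r1, length r2)" "(length r1, length r2) \<in> {1..l}\<times>{1..l}"
      by (auto simp: shared_pairs_def Y_def j_def cyc_words_def Suc_le_eq)
    thus "(r1, r2) \<in> (\<Union>z\<in>{1..l}\<times>{1..l}. Y z)" by blast
  qed
  have Y: "real (card (Y z)) \<le> 16 * real l ^ 2 * real q powr ((2 - c) * real l)"
    if z: "z \<in> {1..l}\<times>{1..l}" for z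
  proof -
    obtain k1 k2 where k: "z = (k1, k2)" "1 \<le> k1" "k1 \<le> l" "1 \<le> k2" "k2 \<le> l" using z by auto
    show ?thesis
    \<comment> \<open>No pair exists if the subword is longer than the second word; otherwise the
      subtraction \<open>k2 - j k1\<close> is not truncated.\<close>
    proof (cases "j k1 \<le> k2")
      case False
      have "Y z = {}"
        using False prefix_length_le
        by (auto simp: Y_def k occurs_at_orient dest!: prefix_length_le)
      thus ?thesis by simp
    next
      case True
      have "real k1 + real k2 - real (j k1) \<le> real k1 * (1 - c) + real k2"
        using le_of_int_ceiling[of "c * real k1"] c by (simp add: j_def algebra_simps)
      also have "\<dots> \<le> real l * (1 - c) + real l"
        using k c by (intro add_mono mult_right_mono) auto
      finally have e: "real (k1 + (k2 - j k1)) \<le> (2 - c) * real l"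
        using True by (simp add: of_nat_diff algebra_simps)
      have "card (Y z) \<le> 16 * k1 * k2 * q ^ (k1 + (k2 - j k1))"
        using card_shared_pairs_length_le[OF m, of l k1 k2 "j k1"] by (simp add: Y_def k q_def)
      hence "real (card (Y z)) \<le> real (16 * k1 * k2 * q ^ (k1 + (k2 - j k1)))"
        by (simp only: of_nat_le_iff)
      also have "\<dots> = 16 * (real k1 * real k2) * real q powr (real (k1 + (k2 - j k1)))"
        using q by (subst powr_realpow) auto
      also have "\<dots> \<le> 16 * (real l * real l) * real q powr ((2 - c) * real l)"
        using k q e by (intro mult_mono powr_mono) auto
      finally show ?thesis by (simp add: power2_eq_square)
    qed
  qed
  have "card (shared_pairs m l c) \<le> (\<Sum>z\<in>{1..l}\<times>{1..l}. card (Y z))"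
    using card_mono[OF _ sub] card_UN_le[of "{1..l}\<times>{1..l}" Y] finY by fastforce
  hence "real (card (shared_pairs m l c)) \<le> (\<Sum>z\<in>{1..l}\<times>{1..l}. real (card (Y z)))"
    unfolding of_nat_sum[symmetric] of_nat_le_iff .
  also have "\<dots> \<le> (\<Sum>z\<in>{1..l}\<times>{1..l}. 16 * real l ^ 2 * real q powr ((2 - c) * real l))"
    by (intro sum_mono Y)
  also have "\<dots> = 16 * real l ^ 4 * real q powr ((2 - c) * real l)"
    by (simp add: card_cartesian_product power_numeral_reduce)
  finally show ?thesis by (simp add: q_def)
qed

text \<open>The block has about half the length of the repeated subword, which turns
  \<open>c\<close> into \<open>c / 2\<close>; rounding in \<open>div 2\<close> costs the
  \<open>+ 1\<close> in the exponent. The polynomial factor counts lengths, starting points,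
  distances and two flags.\<close>

lemma card_self_sharing_le:
  assumes m: "m \<ge> 1" and c: "0 < c" "c < 1"
  shows "real (card (self_sharing m l c))
    \<le> 16 * real l ^ 2 * real (l + 1) * real (2 * m - 1) powr ((1 - c / 2) * real l + 1)"
proof -
  define q where "q = 2 * m - 1"
  have q: "q \<ge> 1" using m by (simp add: q_def)
  define h where "h k = nat \<lceil>c * real k\<rceil> div 2" for k
  define I where "I = {1..l} \<times> (UNIV :: bool set) \<times> {..<l} \<times> {..l} \<times> (UNIV :: bool set)"
  define X where "X = (\<lambda>(k, b, i, t, d). (\<lambda>r. rotate i (orient b r)) -` block_copy m k (h k) t d)"
  have fin_bc: "finite (block_copy m k (h k) t d)" for k t d
    by (rule finite_subset[of _ "red_words m k"]) (auto simp: block_copy_def)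
  have finX: "finite (X z)" for z
    by (cases z) (auto simp: X_def intro!: finite_vimageI fin_bc inj_rotate_orient)
  have finI: "finite I" by (simp add: I_def)
  have sub: "self_sharing m l c \<subseteq> (\<Union>z\<in>I. X z)"
  proof
    fix r assume "r \<in> self_sharing m l c"
    then obtain p b1 i1 b2 i2 where r: "r \<in> cyc_words m l"
        "length p = nat \<lceil>c * real (length r)\<rceil>" "occurs_at p r b1 i1" "occurs_at p r b2 i2"
        "(b1, i1) \<noteq> (b2, i2)"
      unfolding self_sharing_def by blast
    have k: "length r \<in> {1..l}" using r(1) by (auto simp: cyc_words_def Suc_le_eq)
    obtain b i t d where *: "i < length r" "t \<le> length r"
        "rotate i (orient b r) \<in> block_copy m (length r) (length p div 2) t d"
      using self_overlap[OF r(1,3,4,5)] by blast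
    have "r \<in> X (length r, b, i, t, d)" "(length r, b, i, t, d) \<in> I"
      using * k r(2) by (auto simp: X_def I_def h_def)
    thus "r \<in> (\<Union>z\<in>I. X z)" by blast
  qed
  have X: "real (card (X z)) \<le> 4 * real q powr ((1 - c / 2) * real l + 1)" if z: "z \<in> I" for z
  proof -
    obtain k b i t d where k: "z = (k, b, i, t, d)" "k \<le> l" using z by (auto simp: I_def)
    have "card (X z) \<le> card (block_copy m k (h k) t d)"
      using card_vimage_inj_on_le[where D = UNIV, OF inj_rotate_orient fin_bc, of i b k t d]
      by (simp add: X_def k)
    also have "\<dots> \<le> 4 * q ^ (k - h k)"
      using card_block_copy_le[OF m] by (simp add: q_def)
    finally have "real (card (X z)) \<le> real (4 * q ^ (k - h k))"
      by (simp only: of_nat_le_iff)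
    also have "\<dots> = 4 * real q powr real (k - h k)"
      using q by (subst powr_realpow) auto
    also have "\<dots> \<le> 4 * real q powr ((1 - c / 2) * real l + 1)"
    proof (intro mult_left_mono powr_mono)
      have "c * real k \<le> real k" using c by (simp add: mult_left_le_one_le)
      hence "nat \<lceil>c * real k\<rceil> \<le> k" by (simp add: nat_le_iff ceiling_le_iff)
      hence hk: "h k \<le> k" unfolding h_def by (rule order.trans[OF div_le_dividend])
      have "n \<le> 2 * (n div 2) + 1" for n :: nat by presburger
      hence "nat \<lceil>c * real k\<rceil> \<le> 2 * h k + 1" unfolding h_def .
      hence "real (nat \<lceil>c * real k\<rceil>) \<le> real (2 * h k + 1)" by (simp only: of_nat_le_iff)
      hence "c * real k \<le> 2 * real (h k) + 1"
        using real_nat_ceiling_ge[of "c * real k"] by simp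
      hence "real (k - h k) \<le> (1 - c / 2) * real k + 1"
        using hk by (simp add: of_nat_diff algebra_simps)
      also have "\<dots> \<le> (1 - c / 2) * real l + 1"
        using k c by (intro add_mono mult_left_mono) auto
      finally show "real (k - h k) \<le> (1 - c / 2) * real l + 1" .
    qed (use q in auto)
    finally show ?thesis .
  qed
  have "card (self_sharing m l c) \<le> (\<Sum>z\<in>I. card (X z))"
    using card_mono[OF _ sub] card_UN_le[OF finI, of X] finI finX by fastforce
  hence "real (card (self_sharing m l c)) \<le> (\<Sum>z\<in>I. real (card (X z)))"
    unfolding of_nat_sum[symmetric] of_nat_le_iff .
  also have "\<dots> \<le> (\<Sum>z\<in>I. 4 * real q powr ((1 - c / 2) * real l + 1))"
    by (intro sum_mono X)
  also have "\<dots> = 16 * real l ^ 2 * real (l + 1) * real q powr ((1 - c / 2) * real l + 1)"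
    by (simp add: I_def card_cartesian_product power2_eq_square algebra_simps)
  finally show ?thesis by (simp add: q_def)
qed

section \<open>First moment estimate, birthday argument and passage to the limit\<close>

section \<open>Both sides of the critical density\<close>

text \<open>Union bound: each violating set contains an obstruction, and the number of obstructions
  of each kind is multiplied by a bound for the proportion of \<open>k\<close>-sets containing a
  given one.\<close>

lemma card_not_small_cancellation_le:
  assumes "k \<le> card (cyc_words m l)"
  defines "N \<equiv> real (card (cyc_words m l))"
  shows "real (card {r. r \<subseteq> cyc_words m l \<and> \<not> small_cancellation c r \<and> card r = k})
    \<le> (real (card (shared_pairs m l c)) * (real k / N)\<^sup>2
       + real (card (self_sharing m l c)) * (real k / N)) * real (card (cyc_words m l) choose k)"
proof -
  let ?B = "cyc_words m l" and ?P = "shared_pairs m l c" and ?S = "self_sharing m l c"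
  let ?C = "real (card ?B choose k)"
  define U where "U = (\<lambda>(x, y). {r. r \<subseteq> ?B \<and> card r = k \<and> x \<in> r \<and> y \<in> r})"
  define V where "V x = {r. r \<subseteq> ?B \<and> card r = k \<and> x \<in> r}" for x
  have fin: "finite ?P" "finite ?S"
    by (rule finite_subset[of _ "?B \<times> ?B"], auto simp: shared_pairs_def)
       (auto simp: self_sharing_def)
  have finUV: "finite (U z)" "finite (V x)" for z x
    by (auto simp: U_def V_def split: prod.splits intro: rev_finite_subset[of "Pow ?B"])
  have "{r. r \<subseteq> ?B \<and> \<not> small_cancellation c r \<and> card r = k} \<subseteq> (\<Union>z\<in>?P. U z) \<union> (\<Union>x\<in>?S. V x)"
  proof clarify
    fix r assume r: "r \<subseteq> ?B" "\<not> small_cancellation c r" "k = card r" "r \<notin> (\<Union>x\<in>?S. V x)"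
    from r(1,2) show "r \<in> (\<Union>z\<in>?P. U z)"
    proof (cases rule: not_small_cancellation_cases)
      case (1 x y)
      thus ?thesis using r by (intro UN_I[of "(x, y)"]) (auto simp: U_def)
    next
      case (2 x)
      thus ?thesis using r by (auto simp: V_def)
    qed
  qed
  hence "card {r. r \<subseteq> ?B \<and> \<not> small_cancellation c r \<and> card r = k}
      \<le> card ((\<Union>z\<in>?P. U z) \<union> (\<Union>x\<in>?S. V x))"
    using fin finUV by (intro card_mono) auto
  also have "\<dots> \<le> (\<Sum>z\<in>?P. card (U z)) + (\<Sum>x\<in>?S. card (V x))"
    using card_Un_le[of "\<Union>z\<in>?P. U z" "\<Union>x\<in>?S. V x"] card_UN_le[OF fin(1), of U]
      card_UN_le[OF fin(2), of V] by linarith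
  finally have "real (card {r. r \<subseteq> ?B \<and> \<not> small_cancellation c r \<and> card r = k})
      \<le> real ((\<Sum>z\<in>?P. card (U z)) + (\<Sum>x\<in>?S. card (V x)))"
    by (simp only: of_nat_le_iff)
  also have "\<dots> = (\<Sum>z\<in>?P. real (card (U z))) + (\<Sum>x\<in>?S. real (card (V x)))"
    by simp
  also have "\<dots> \<le> (\<Sum>z\<in>?P. (real k / N)\<^sup>2 * ?C) + (\<Sum>x\<in>?S. real k / N * ?C)"
  proof (intro add_mono sum_mono)
    fix z assume "z \<in> ?P"
    thus "real (card (U z)) \<le> (real k / N)\<^sup>2 * ?C"
      unfolding N_def U_def
      by (cases z) (auto simp: shared_pairs_def intro!: card_supersets_pair_le assms)
  next
    fix x assume "x \<in> ?S"
    thus "real (card (V x)) \<le> real k / N * ?C"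
      unfolding N_def V_def
      by (intro card_supersets_singleton_le) (auto simp: self_sharing_def)
  qed
  also have "\<dots> = (real (card ?P) * (real k / N)\<^sup>2 + real (card ?S) * (real k / N)) * ?C"
    by (simp add: algebra_simps)
  finally show ?thesis .
qed

text \<open>Two relators with the same first \<open>nat \<lceil>c * real l\<rceil>\<close> letters
  share a piece that is too long for words of length at most \<open>l\<close>, so the sets
  satisfying the condition are hit-free for the family \<open>H\<close> below.\<close>

lemma card_small_cancellation_le:
  assumes m: "m \<ge> 2" and c: "c > 0" and j: "nat \<lceil>c * real l\<rceil> < l"
  defines "s \<equiv> (2 * m - 1) ^ (l - nat \<lceil>c * real l\<rceil> - 1)"
  shows "real (card {r. r \<subseteq> cyc_words m l \<and> small_cancellation c r \<and> card r = k})
    \<le> exp (- (real k * (real k - 1) * (real s - 1) / (2 * real (card (cyc_words m l)))))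
       * real (card (cyc_words m l) choose k)"
proof -
  define j where "j = nat \<lceil>c * real l\<rceil>"
  let ?B = "cyc_words m l"
  \<comment> \<open>For a word shorter than \<open>j\<close> this is the set of all its extensions;
    a shorter prefix only has more of them, so the lower bound \<open>s\<close> persists.\<close>
  define H where "H w = {v \<in> ?B. prefix (take j w) v}" for w
  have s1: "s \<ge> 1" using m by (simp add: s_def)
  have jl: "j < l" using assms by (simp add: j_def)
  have j0: "j > 0" using c jl by (simp add: j_def)
  have Hs: "s \<le> card (H w)" if w: "w \<in> ?B" for w
  proof -
    have "w \<in> red_words m (length w)"
      using w by (auto simp: cyc_words_def red_words_def cyclically_reduced_def)
    hence "take j w \<in> red_words m (min j (length w))"
      using take_in_red_words[of w m "length w" "min j (length w)"]
      by (cases "j \<le> length w") (auto simp: min_def)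
    hence "(2 * m - 1) ^ (l - min j (length w) - 1) \<le> card (H w)"
      unfolding H_def using w j0 jl m
      by (intro card_cyc_words_prefix_ge) (auto simp: cyc_words_def)
    moreover have "s \<le> (2 * m - 1) ^ (l - min j (length w) - 1)"
      unfolding s_def j_def[symmetric] using m by (intro power_increasing) auto
    ultimately show ?thesis by linarith
  qed
  have disj: "H x \<inter> H y = {}" if "x \<in> ?B" "y \<in> ?B" "x \<notin> H y" "y \<notin> H x" for x y
  proof (rule ccontr)
    assume "H x \<inter> H y \<noteq> {}"
    \<comment> \<open>Prefixes of a common word are comparable, so an intersection puts one of
      \<open>x\<close>, \<open>y\<close> into the set of the other.\<close>
    then obtain v where "prefix (take j x) v" "prefix (take j y) v" by (auto simp: H_def)
    hence "prefix (take j x) (take j y) \<or> prefix (take j y) (take j x)"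
      by (rule prefix_same_cases)
    hence "prefix (take j x) y \<or> prefix (take j y) x"
      using prefix_order.trans[OF _ take_is_prefix[of j y]]
        prefix_order.trans[OF _ take_is_prefix[of j x]] by blast
    thus False using that by (auto simp: H_def)
  qed
  have sub: "{r. r \<subseteq> ?B \<and> small_cancellation c r \<and> card r = k} \<subseteq> hit_free ?B H k"
  proof clarify
    fix r assume r: "r \<subseteq> ?B" "small_cancellation c r"
    have False if xy: "x \<in> r" "y \<in> r" "x \<noteq> y" "y \<in> H x" for x y
    proof -
      have ne: "x \<noteq> []" "y \<noteq> []" using r xy by (auto simp: cyc_words_def)
      have occ: "occurs_at (take j x) x True 0" "occurs_at (take j x) y True 0"
        using ne xy take_is_prefix by (auto simp: occurs_at_def H_def)
      have "piece r (take j x)"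
        using occ xy unfolding piece_def by blast
      hence "real (length (take j x)) < c * real (length x)"
        using r(2) xy occ unfolding small_cancellation_def by blast
      moreover have "c * real (length x) \<le> real j"
      proof -
        have "c * real (length x) \<le> c * real l"
          using xy r c by (intro mult_left_mono) (auto simp: cyc_words_def)
        also have "\<dots> \<le> real j" unfolding j_def by (rule real_nat_ceiling_ge)
        finally show ?thesis .
      qed
      \<comment> \<open>If \<open>x\<close> has fewer than \<open>j\<close> letters, the piece is
        all of \<open>x\<close>; it is still too long since \<open>j < l\<close> forces
        \<open>c \<le> 1\<close>.\<close>
      moreover have "c * real (length x) \<le> real (length x)" if "length x < j"
      proof -
        have "c \<le> 1"
        proof (rule ccontr)
          assume "\<not> c \<le> 1"
          hence "1 * real l \<le> c * real l" by (intro mult_right_mono) auto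
          also have "\<dots> \<le> real j" unfolding j_def by (rule real_nat_ceiling_ge)
          finally show False using jl by simp
        qed
        thus ?thesis using c by (simp add: mult_left_le_one_le)
      qed
      ultimately show False by (cases "length x < j") auto
    qed
    thus "r \<in> hit_free ?B H (card r)" using r by (auto simp: hit_free_def)
  qed
  have "real (card {r. r \<subseteq> ?B \<and> small_cancellation c r \<and> card r = k}) \<le> real (card (hit_free ?B H k))"
    using card_mono[OF finite_hit_free sub] by simp
  also have "\<dots> \<le> exp (- (real k * (real k - 1) * (real s - 1) / (2 * real (card ?B))))
      * real (card ?B choose k)"
    by (rule card_hit_free_le[OF _ _ Hs disj s1]) (auto simp: H_def)
  finally show ?thesis .
qed

text \<open>\<open>Z\<close> stands for an untypical cardinality, made unlikely by convergence in
  distribution; the remaining bad sets are counted in each cardinality, with one bound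
  \<open>\<epsilon> l\<close> for all \<open>k\<close>.\<close>

lemma asymptotically_almost_surelyI:
  assumes rg: "random_groups m d M R"
    and Z: "(\<lambda>l. \<P>(\<omega> in M l. Z l (R l \<omega>))) \<longlonglongrightarrow> 0"
    and count: "\<forall>\<^sub>F l in sequentially. \<forall>k\<le>card (cyc_words m l).
      real (card {r. r \<subseteq> cyc_words m l \<and> \<not> Q r \<and> \<not> Z l r \<and> card r = k})
        \<le> \<epsilon> l * real (card (cyc_words m l) choose k)"
    and \<epsilon>: "\<epsilon> \<longlonglongrightarrow> 0" "\<And>l. \<epsilon> l \<ge> 0"
  shows "asymptotically_almost_surely M (\<lambda>l \<omega>. Q (R l \<omega>))"
proof -
  have ev: "\<forall>\<^sub>F l in sequentially. \<P>(\<omega> in M l. Q (R l \<omega>)) \<le> 1 \<and>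
      1 - (\<epsilon> l + \<P>(\<omega> in M l. Z l (R l \<omega>))) \<le> \<P>(\<omega> in M l. Q (R l \<omega>))"
    using count eventually_ge_at_top[of 1]
  proof eventually_elim
    case (elim l)
    have RS: "random_subset (M l) (cyc_words m l) (R l)"
      and PI: "permutation_invariant (M l) (cyc_words m l) (R l)"
      using rg elim(2) by (auto simp: random_groups_def)
    interpret prob_space "M l" using RS by (simp add: random_subset_def)
    note ev = random_subset_sets[OF RS]
    let ?F = "{r. r \<subseteq> cyc_words m l \<and> \<not> Q r \<and> \<not> Z l r}"
    have "R l \<in> measurable (M l) (count_space (Pow (cyc_words m l)))"
      using RS by (simp add: random_subset_def)
    hence in_B: "R l \<omega> \<subseteq> cyc_words m l" if "\<omega> \<in> space (M l)" for \<omega>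
      using measurable_space[OF _ that] by (metis PowD space_count_space)
    have F: "prob {\<omega> \<in> space (M l). R l \<omega> \<in> ?F} \<le> \<epsilon> l"
      by (rule permutation_invariant_prob_le[OF RS PI])
         (use elim(1) \<epsilon>(2) in \<open>auto simp: conj_assoc\<close>)
    have "prob {\<omega> \<in> space (M l). \<not> Q (R l \<omega>)}
        \<le> prob ({\<omega> \<in> space (M l). R l \<omega> \<in> ?F} \<union> {\<omega> \<in> space (M l). Z l (R l \<omega>)})"
      by (rule finite_measure_mono[OF _ sets.Un[OF ev ev]]) (use in_B in auto)
    also have "\<dots> \<le> prob {\<omega> \<in> space (M l). R l \<omega> \<in> ?F} + prob {\<omega> \<in> space (M l). Z l (R l \<omega>)}"
      by (rule measure_Un_le[OF ev ev])
    finally have "prob {\<omega> \<in> space (M l). \<not> Q (R l \<omega>)}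
        \<le> \<epsilon> l + prob {\<omega> \<in> space (M l). Z l (R l \<omega>)}" using F by linarith
    moreover have "prob {\<omega> \<in> space (M l). \<not> Q (R l \<omega>)} = 1 - prob {\<omega> \<in> space (M l). Q (R l \<omega>)}"
      by (rule prob_neg[OF ev])
    ultimately show ?case by simp
  qed
  have "(\<lambda>l. 1 - (\<epsilon> l + \<P>(\<omega> in M l. Z l (R l \<omega>)))) \<longlonglongrightarrow> 1 - (0 + 0)"
    by (intro tendsto_intros \<epsilon> Z)
  hence lim: "(\<lambda>l. 1 - (\<epsilon> l + \<P>(\<omega> in M l. Z l (R l \<omega>)))) \<longlonglongrightarrow> 1" by simp
  show ?thesis
    unfolding asymptotically_almost_surely_def
  proof (rule tendsto_sandwich[OF _ _ lim tendsto_const])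
    show "\<forall>\<^sub>F l in sequentially. 1 - (\<epsilon> l + \<P>(\<omega> in M l. Z l (R l \<omega>)))
        \<le> \<P>(\<omega> in M l. Q (R l \<omega>))"
      using ev by (rule eventually_mono) (rule conjunct2)
    show "\<forall>\<^sub>F l in sequentially. \<P>(\<omega> in M l. Q (R l \<omega>)) \<le> 1"
      using ev by (rule eventually_mono) (rule conjunct1)
  qed
qed

lemma log_card_ge_iff:
  "card B > 1 \<Longrightarrow> ereal a \<le> log_card B r \<longleftrightarrow> card r > 0 \<and> real (card B) powr a \<le> real (card r)"
  by (auto simp: log_card_def le_log_iff)

lemma log_card_le_iff:
  "card B > 1 \<Longrightarrow> log_card B r \<le> ereal a \<longleftrightarrow> card r = 0 \<or> real (card r) \<le> real (card B) powr a"
  by (auto simp: log_card_def log_le_iff)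

lemma real_card_cyc_words_ge:
  assumes "m \<ge> 2" "l \<ge> 2"
  shows "real (2 * m - 1) powr (real l - 2) \<le> real (card (cyc_words m l))"
proof -
  have "real ((2 * m - 1) ^ (l - 2)) \<le> real (card (cyc_words m l))"
    unfolding of_nat_le_iff by (rule card_cyc_words_ge[OF assms])
  moreover have "real (2 * m - 1) powr real (l - 2) = real (2 * m - 1) ^ (l - 2)"
    using assms by (intro powr_realpow) auto
  ultimately show ?thesis using assms by (simp add: of_nat_diff)
qed

lemma random_groups_eventually_random_subset:
  "random_groups m d M R \<Longrightarrow> \<forall>\<^sub>F l in sequentially. random_subset (M l) (cyc_words m l) (R l)"
  using eventually_ge_at_top[of "1::nat"]
  by eventually_elim (auto simp: random_groups_def)

lemma eventually_real_ge: "\<forall>\<^sub>F l in sequentially. C \<le> real l"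
  using filterlim_real_sequentially unfolding filterlim_at_top by blast

text \<open>With \<open>\<delta>\<close> between \<open>d\<close> and \<open>c / 2\<close>,
  typically \<open>k\<close> is at most \<open>N powr \<delta>\<close>. Up to polynomial factors the
  two parts of the first moment bound then decay like \<open>q powr ((2 * \<delta> - c) * l)\<close>
  and its square root.\<close>

lemma small_cancellation_below_critical_density:
  assumes m: "m \<ge> 2" and rg: "random_groups m d M R"
    and c: "0 < c" "c < 1" and d: "d < ereal (c / 2)"
  shows "asymptotically_almost_surely M (\<lambda>l \<omega>. small_cancellation c (R l \<omega>))"
proof -
  define q where "q = real (2 * m - 1)"
  have q: "q \<ge> 3" using m by (simp add: q_def)
  define N where "N l = real (card (cyc_words m l))" for l
  have "max d 0 < ereal (c / 2)" using d c by simp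
  then obtain \<delta> where "max d 0 < ereal \<delta>" "ereal \<delta> < ereal (c / 2)"
    using ereal_dense2 by blast
  hence \<delta>: "d < ereal \<delta>" "0 < \<delta>" "\<delta> < c / 2" by auto
  \<comment> \<open>An upper bound for \<open>N l powr (\<delta> - 1)\<close>: the exponent is
    negative, so the lower bound \<open>q powr (l - 2)\<close> for \<open>N l\<close> is what
    enters.\<close>
  define \<kappa> where "\<kappa> l = q powr ((\<delta> - 1) * (real l - 2))" for l
  define \<epsilon> where "\<epsilon> l = (16 * real l ^ 4 * q powr ((2 - c) * real l)) * (\<kappa> l)\<^sup>2
    + (16 * real l ^ 2 * real (l + 1) * q powr ((1 - c / 2) * real l + 1)) * \<kappa> l" for l
  show ?thesis
  proof (rule asymptotically_almost_surelyI[OF rg, where \<epsilon> = \<epsilon>])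
    show "(\<lambda>l. \<P>(\<omega> in M l. ereal \<delta> \<le> log_card (cyc_words m l) (R l \<omega>))) \<longlonglongrightarrow> 0"
    proof (rule converges_in_distribution_prob_ge
          [where Y = "\<lambda>l. log_card (cyc_words m l)", OF _ random_groups_eventually_random_subset[OF rg]])
      show "converges_in_distribution_to_const M (\<lambda>l \<omega>. log_card (cyc_words m l) (R l \<omega>)) d"
        using rg by (simp add: random_groups_def densable_with_density_def)
    qed (rule \<delta>(1))
  next
    show "\<forall>\<^sub>F l in sequentially. \<forall>k\<le>card (cyc_words m l).
        real (card {r. r \<subseteq> cyc_words m l \<and> \<not> small_cancellation c r \<and>
            \<not> ereal \<delta> \<le> log_card (cyc_words m l) r \<and> card r = k})
          \<le> \<epsilon> l * real (card (cyc_words m l) choose k)"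
      using eventually_ge_at_top[of 3]
    proof eventually_elim
      case (elim l)
      let ?B = "cyc_words m l"
      have Nq: "q powr (real l - 2) \<le> N l"
        using real_card_cyc_words_ge[OF m, of l] elim by (simp add: N_def q_def)
      have "q powr 1 \<le> q powr (real l - 2)" using elim q by (intro powr_mono) auto
      hence N1: "N l > 1" using Nq q by simp
      hence B1: "card ?B > 1" by (simp add: N_def)
      show ?case
      proof (intro allI impI)
        fix k assume k: "k \<le> card ?B"
        let ?A = "{r. r \<subseteq> ?B \<and> \<not> small_cancellation c r \<and>
            \<not> ereal \<delta> \<le> log_card ?B r \<and> card r = k}"
        show "real (card ?A) \<le> \<epsilon> l * real (card ?B choose k)"
        proof (cases "real k \<le> N l powr \<delta>")
          case False
          hence "k > 0" using powr_ge_zero[of "N l" \<delta>] by (cases k) auto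
          \<comment> \<open>Sets of this size belong to the exceptional event.\<close>
          have "?A = {}"
          proof (rule equals0I)
            fix r assume r: "r \<in> ?A"
            have "ereal \<delta> \<le> log_card ?B r"
              unfolding log_card_ge_iff[OF B1] using r False \<open>k > 0\<close> by (simp add: N_def)
            thus False using r by simp
          qed
          thus ?thesis by (simp only: card.empty) (simp add: \<epsilon>_def \<kappa>_def)
        next
          case True
          have "real k / N l \<le> N l powr \<delta> / N l" using True N1 by (simp add: divide_right_mono)
          also have "\<dots> = N l powr (\<delta> - 1)" using N1 by (simp add: powr_diff)
          also have "\<dots> \<le> (q powr (real l - 2)) powr (\<delta> - 1)"
            using Nq \<delta> c q by (intro powr_mono2') auto
          also have "\<dots> = \<kappa> l" by (simp add: powr_powr \<kappa>_def mult.commute)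
          finally have kN: "real k / N l \<le> \<kappa> l" .
          have kN0: "0 \<le> real k / N l" using N1 by simp
          have "card ?A \<le> card {r. r \<subseteq> ?B \<and> \<not> small_cancellation c r \<and> card r = k}"
            by (rule card_mono) (auto simp: finite_subset[of _ "Pow ?B"])
          hence "real (card ?A)
              \<le> real (card {r. r \<subseteq> ?B \<and> \<not> small_cancellation c r \<and> card r = k})" by simp
          also have "\<dots> \<le> (real (card (shared_pairs m l c)) * (real k / N l)\<^sup>2
              + real (card (self_sharing m l c)) * (real k / N l)) * real (card ?B choose k)"
            unfolding N_def by (rule card_not_small_cancellation_le[OF k])
          also have "\<dots> \<le> \<epsilon> l * real (card ?B choose k)"
          proof (rule mult_right_mono)
            have "(real k / N l)\<^sup>2 \<le> (\<kappa> l)\<^sup>2" using kN kN0 by (rule power_mono)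
            moreover have "real (card (shared_pairs m l c)) \<le> 16 * real l ^ 4 * q powr ((2 - c) * real l)"
              "real (card (self_sharing m l c))
                \<le> 16 * real l ^ 2 * real (l + 1) * q powr ((1 - c / 2) * real l + 1)"
              unfolding q_def using m c
              by (intro card_shared_pairs_le card_self_sharing_le; simp)+
            ultimately show "real (card (shared_pairs m l c)) * (real k / N l)\<^sup>2
                + real (card (self_sharing m l c)) * (real k / N l) \<le> \<epsilon> l"
              unfolding \<epsilon>_def using kN kN0 by (intro add_mono mult_mono) simp_all
          qed simp
          finally show ?thesis .
        qed
      qed
    qed
  next
    \<comment> \<open>The decay rate of the contribution of pairs; single words contribute with rate
      \<open>a / 2\<close>.\<close>
    define a where "a = (c - 2 * \<delta>) * ln q"
    have a: "a > 0" using \<delta> q by (simp add: a_def)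
    have eq: "\<epsilon> = (\<lambda>l. 16 * q powr (4 * (1 - \<delta>)) * (real l ^ 4 * exp (- a * real l))
        + 16 * q powr (1 + 2 * (1 - \<delta>)) * (real l ^ 2 * real (l + 1) * exp (- (a / 2) * real l)))"
    proof
      fix l
      have e: "q powr x = exp (x * ln q)" for x using q by (simp add: powr_def)
      have e1: "q powr ((2 - c) * real l) * (\<kappa> l)\<^sup>2 = q powr (4 * (1 - \<delta>)) * exp (- a * real l)"
        unfolding \<kappa>_def e power2_eq_square exp_add[symmetric] a_def by (simp add: algebra_simps)
      have e2: "q powr ((1 - c / 2) * real l + 1) * \<kappa> l
          = q powr (1 + 2 * (1 - \<delta>)) * exp (- (a / 2) * real l)"
        unfolding \<kappa>_def e exp_add[symmetric] a_def by (simp add: field_simps)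
      show "\<epsilon> l = 16 * q powr (4 * (1 - \<delta>)) * (real l ^ 4 * exp (- a * real l))
        + 16 * q powr (1 + 2 * (1 - \<delta>)) * (real l ^ 2 * real (l + 1) * exp (- (a / 2) * real l))"
        unfolding \<epsilon>_def mult.assoc e1 e2 by (simp only: mult_ac)
    qed
    have lim: "(\<lambda>l. real l ^ 4 * exp (- a * real l)) \<longlonglongrightarrow> 0"
      "(\<lambda>l. real l ^ 2 * real (l + 1) * exp (- (a / 2) * real l)) \<longlonglongrightarrow> 0"
      using a by real_asymp+
    have "\<epsilon> \<longlonglongrightarrow> 16 * q powr (4 * (1 - \<delta>)) * 0 + 16 * q powr (1 + 2 * (1 - \<delta>)) * 0"
      unfolding eq by (intro tendsto_add tendsto_mult_left lim)
    thus "\<epsilon> \<longlonglongrightarrow> 0" by simp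
  qed (simp add: \<epsilon>_def \<kappa>_def)
qed

text \<open>With \<open>\<delta>\<close> between \<open>c / 2\<close> and \<open>d\<close>,
  typically \<open>k\<close> exceeds \<open>N powr \<delta>\<close>, and the exponent in the
  birthday bound is at least of order \<open>q powr ((2 * \<delta> - c) * l) / l\<close>, which
  tends to infinity.\<close>

lemma not_small_cancellation_above_critical_density:
  assumes m: "m \<ge> 2" and rg: "random_groups m d M R"
    and c: "0 < c" "c < 1" and d: "ereal (c / 2) < d"
  shows "asymptotically_almost_surely M (\<lambda>l \<omega>. \<not> small_cancellation c (R l \<omega>))"
proof -
  define q where "q = real (2 * m - 1)"
  have q: "q \<ge> 3" using m by (simp add: q_def)
  define N where "N l = real (card (cyc_words m l))" for l
  obtain \<delta> where "ereal (c / 2) < ereal \<delta>" "ereal \<delta> < d"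
    using ereal_dense2[OF d] by blast
  hence \<delta>: "ereal \<delta> < d" "c / 2 < \<delta>" "0 < \<delta>" using c by auto
  \<comment> \<open>A lower bound for \<open>k * (k - 1) * (s - 1) / (2 * N)\<close>, from
    \<open>k \<ge> q powr (\<delta> * (l - 2))\<close>,
    \<open>s \<ge> q powr (l - c * l - 2)\<close> and \<open>N \<le> 2 * (l + 1) * q powr l\<close>.
    Replacing \<open>k - 1\<close> and \<open>s - 1\<close> by half the bounds for \<open>k\<close>
    and \<open>s\<close> makes the constant 16.\<close>
  define z where "z l = q powr (2 * \<delta> * (real l - 2) - c * real l - 2) / (16 * real (l + 1))" for l
  show ?thesis
  proof (rule asymptotically_almost_surelyI[OF rg, where \<epsilon> = "\<lambda>l. exp (- z l)"])
    show "(\<lambda>l. \<P>(\<omega> in M l. log_card (cyc_words m l) (R l \<omega>) \<le> ereal \<delta>)) \<longlonglongrightarrow> 0"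
    proof (rule converges_in_distribution_prob_le
          [where Y = "\<lambda>l. log_card (cyc_words m l)", OF _ random_groups_eventually_random_subset[OF rg]])
      show "converges_in_distribution_to_const M (\<lambda>l \<omega>. log_card (cyc_words m l) (R l \<omega>)) d"
        using rg by (simp add: random_groups_def densable_with_density_def)
    qed (rule \<delta>(1))
  next
    show "\<forall>\<^sub>F l in sequentially. \<forall>k\<le>card (cyc_words m l).
        real (card {r. r \<subseteq> cyc_words m l \<and> \<not> \<not> small_cancellation c r \<and>
            \<not> log_card (cyc_words m l) r \<le> ereal \<delta> \<and> card r = k})
          \<le> exp (- z l) * real (card (cyc_words m l) choose k)"
      \<comment> \<open>The thresholds give, in this order, \<open>N l \<ge> q\<close>, then
        \<open>j + 2 \<le> l\<close> and hence \<open>s \<ge> q\<close>, and finally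
        \<open>X \<ge> q\<close>.\<close>
      using eventually_ge_at_top[of 3] eventually_real_ge[of "3 / (1 - c)"]
        eventually_real_ge[of "1 / \<delta> + 2"]
    proof eventually_elim
      case (elim l)
      let ?B = "cyc_words m l"
      define j where "j = nat \<lceil>c * real l\<rceil>"
      define s where "s = (2 * m - 1) ^ (l - j - 1)"
      have "3 \<le> (1 - c) * real l" using elim(2) c by (simp add: field_simps)
      moreover have jc: "real j \<le> c * real l + 1" using c by (simp add: j_def)
      ultimately have "real j + 2 \<le> real l" by (simp add: algebra_simps)
      hence jl: "j + 2 \<le> l" by linarith
      have Nq: "q powr (real l - 2) \<le> N l"
        using real_card_cyc_words_ge[OF m, of l] elim by (simp add: N_def q_def)
      have "q powr 1 \<le> q powr (real l - 2)" using elim q by (intro powr_mono) auto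
      hence N1: "N l > 1" using Nq q by simp
      hence B1: "card ?B > 1" by (simp add: N_def)
      have "real (card ?B) \<le> real (2 * (l + 1) * (2 * m - 1) ^ l)"
        unfolding of_nat_le_iff using m by (intro card_cyc_words_le) auto
      also have "\<dots> = 2 * real (l + 1) * q powr real l"
      proof -
        have qp: "q powr real l = q ^ l" using q by (intro powr_realpow) auto
        show ?thesis unfolding qp by (simp only: q_def of_nat_mult of_nat_power of_nat_numeral)
      qed
      finally have Nle: "N l \<le> 2 * real (l + 1) * q powr real l" by (simp add: N_def)
      have sq: "real s = q powr (real l - real j - 1)"
      proof -
        have "real s = q ^ (l - j - 1)" by (simp add: s_def q_def)
        also have "\<dots> = q powr real (l - j - 1)" using q by (subst powr_realpow) auto
        also have "real (l - j - 1) = real l - real j - 1" using jl by (simp add: of_nat_diff)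
        finally show ?thesis .
      qed
      have "q powr 1 \<le> real s" unfolding sq using jl q by (intro powr_mono) auto
      hence s2: "real s \<ge> 2" using q by simp
      define X where "X = q powr (\<delta> * (real l - 2))"
      have "1 \<le> \<delta> * (real l - 2)" using elim(3) \<delta> by (simp add: field_simps)
      hence "q powr 1 \<le> X" unfolding X_def using q by (intro powr_mono) auto
      hence X2: "X \<ge> 2" using q by simp
      have XN: "X \<le> N l powr \<delta>"
      proof -
        have "X = (q powr (real l - 2)) powr \<delta>" by (simp add: X_def powr_powr mult.commute)
        also have "\<dots> \<le> N l powr \<delta>" using Nq \<delta> q by (intro powr_mono2) auto
        finally show ?thesis .
      qed
      show ?case
      proof (intro allI impI)
        fix k assume k: "k \<le> card ?B"
        let ?A = "{r. r \<subseteq> ?B \<and> \<not> \<not> small_cancellation c r \<and>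
            \<not> log_card ?B r \<le> ereal \<delta> \<and> card r = k}"
        show "real (card ?A) \<le> exp (- z l) * real (card ?B choose k)"
        proof (cases "real k \<le> N l powr \<delta>")
          case True
          have "?A = {}"
          proof (rule equals0I)
            fix r assume r: "r \<in> ?A"
            have "log_card ?B r \<le> ereal \<delta>"
              unfolding log_card_le_iff[OF B1] using r True by (simp add: N_def)
            thus False using r by simp
          qed
          thus ?thesis by (simp only: card.empty) simp
        next
          case False
          hence Xk: "X \<le> real k" using XN by simp
          have kk: "real k * (real k - 1) \<ge> X * (X / 2)"
            using Xk X2 by (intro mult_mono) auto
          have "q powr (2 * \<delta> * (real l - 2)) * q powr (real l - c * real l - 2)
              = q powr (2 * \<delta> * (real l - 2) - c * real l - 2) * q powr real l"
            by (simp add: powr_add[symmetric] algebra_simps)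
          moreover have "q powr real l > 0" using q by simp
          ultimately have "z l = (q powr (2 * \<delta> * (real l - 2)) * q powr (real l - c * real l - 2))
              / (8 * (2 * real (l + 1) * q powr real l))"
            by (simp add: z_def)
          also have "q powr (2 * \<delta> * (real l - 2)) = X * X"
            by (simp add: X_def powr_add[symmetric] mult.assoc)
          also have "(X * X * q powr (real l - c * real l - 2)) / (8 * (2 * real (l + 1) * q powr real l))
              \<le> (X * X * real s) / (8 * N l)"
            unfolding sq using Nle N1 q jc
            by (intro frac_le mult_left_mono powr_mono) auto
          also have "\<dots> = (X * (X / 2)) * (real s / 2) / (2 * N l)" by simp
          also have "\<dots> \<le> (real k * (real k - 1)) * (real s - 1) / (2 * N l)"
            using kk s2 N1 X2 Xk by (intro divide_right_mono mult_mono) auto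
          finally have zk: "z l \<le> real k * (real k - 1) * (real s - 1) / (2 * N l)" .
          have "card ?A \<le> card {r. r \<subseteq> ?B \<and> small_cancellation c r \<and> card r = k}"
            by (rule card_mono) (auto simp: finite_subset[of _ "Pow ?B"])
          hence "real (card ?A)
              \<le> real (card {r. r \<subseteq> ?B \<and> small_cancellation c r \<and> card r = k})" by simp
          also have "\<dots> \<le> exp (- (real k * (real k - 1) * (real s - 1) / (2 * N l)))
              * real (card ?B choose k)"
            unfolding N_def s_def j_def using jl
            by (intro card_small_cancellation_le[OF m c(1)]) (auto simp: j_def)
          also have "\<dots> \<le> exp (- z l) * real (card ?B choose k)"
            using zk by (intro mult_right_mono) auto
          finally show ?thesis .
        qed
      qed
    qed
  next
    \<comment> \<open>\<open>a\<close> is the exponential growth rate of \<open>z\<close>, and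
      \<open>K\<close> collects the constants left over from the shifts by 2.\<close>
    define a where "a = (2 * \<delta> - c) * ln q"
    define K where "K = q powr (- 4 * \<delta> - 2) / 16"
    have aK: "a > 0" "K > 0" using \<delta> q by (simp_all add: a_def K_def)
    have "z l = K * (exp (a * real l) / real (l + 1))" for l
    proof -
      have "q powr (2 * \<delta> * (real l - 2) - c * real l - 2) = q powr (- 4 * \<delta> - 2) * exp (a * real l)"
        using q by (simp add: powr_def exp_add[symmetric] a_def algebra_simps)
      thus ?thesis by (simp add: z_def K_def)
    qed
    moreover have "(\<lambda>l. exp (- (K * (exp (a * real l) / real (l + 1))))) \<longlonglongrightarrow> 0"
      using aK by real_asymp
    ultimately show "(\<lambda>l. exp (- z l)) \<longlonglongrightarrow> 0" by simp
  qed simp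
qed

theorem theorem3:
  fixes m :: nat
    and d :: ereal
    and c :: real
    and M :: "nat \<Rightarrow> 'a measure"
    and R :: "nat \<Rightarrow> 'a \<Rightarrow> word set"
  assumes "m \<ge> 2"
    and "d \<in> {-\<infinity>} \<union> {0..1}"
    and "random_groups m d M R"
    and "0 < c" and "c < 1"
  shows "(d < ereal (c / 2) \<longrightarrow>
            asymptotically_almost_surely M (\<lambda>l \<omega>. small_cancellation c (R l \<omega>))) \<and>
         (d > ereal (c / 2) \<longrightarrow>
            asymptotically_almost_surely M (\<lambda>l \<omega>. \<not> small_cancellation c (R l \<omega>)))"
  using small_cancellation_below_critical_density[OF assms(1,3-5)]
    not_small_cancellation_above_critical_density[OF assms(1,3-5)] by simp

end
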